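(* For every integer $n\ge 6$, $$\frac{4}{n}\cdot\sin^2\left(\frac{\pi}{n}\right)\le 1-f_n(n-1)\le \min\left(\frac{1}{n},\ \frac{4}{n}\cdot\sin^2\left(\frac{2\pi}{n}\right)\right).$$
   Context: $\Delta(\cdot)$ denotes area in the Euclidean plane. For integers $n,m$ with $3\le m\le n-1$, define $$f_n(m)=\min_{P\in\mathcal{P}_n}\ \max_{Q\subset P,\ |Q|=m}\frac{\Delta(Q)}{\Delta(P)},$$ where $\mathcal{P}_n$ is the class of all convex $n$-gons in the plane and, for each $P$, the maximum is taken over all convex $m$-gons $Q$ contained in $P$ ($|Q|$ denotes the number of vertices of $Q$). *)

theory Defs
  imports "HOL-Analysis.Analysis"
begin

text \<open>A convex \<open>n\<close>-gon is the filled polygon with exactly \<open>n\<close> vertices; the vertices are the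
  extreme points, so an angle of \<open>\<pi>\<close> at a vertex is excluded.\<close>

definition convex_ngon :: "nat \<Rightarrow> (real^2) set \<Rightarrow> bool" where
  "convex_ngon n P \<longleftrightarrow> polytope P \<and> aff_dim P = 2 \<and> card {v. v extreme_point_of P} = n"

abbreviation area :: "(real^2) set \<Rightarrow> real" where
  "area P \<equiv> measure lebesgue P"

text \<open>The minimum and the maximum are written as infimum and supremum of real numbers. For
  \<open>3 \<le> m\<close> and \<open>m < n\<close> the index sets are nonempty and all ratios lie between \<open>0\<close> and \<open>1\<close>,
  so neither takes the unspecified value that \<open>Inf\<close> and \<open>Sup\<close> have on empty or
  unbounded sets.\<close>

definition max_area_ratio :: "nat \<Rightarrow> (real^2) set \<Rightarrow> real" where
  "max_area_ratio m P = (SUP Q\<in>{Q. convex_ngon m Q \<and> Q \<subseteq> P}. area Q / area P)"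

definition f_ratio :: "nat \<Rightarrow> nat \<Rightarrow> real" where
  "f_ratio n m = (INF P\<in>{P. convex_ngon n P}. max_area_ratio m P)"

end

theory Submission
  imports Defs
begin

text \<open>
  The loss \<open>1 - f_ratio n (n - 1)\<close> is the supremum of all \<open>c\<close> such that some \<open>n\<close>-gon \<open>P\<close> loses at least
  the fraction \<open>c\<close> of its area when it is replaced by any inscribed \<open>(n - 1)\<close>-gon. An upper bound
  comes from cutting off the smallest ear, the triangle of three consecutive vertices; a lower
  bound comes from the regular polygon.

  Upper bound \<open>1 / n\<close>. Let \<open>t\<close> be the least ear area. If a point \<open>p\<close> of \<open>P\<close> lies, for every edge,
  in the hull of the vertices off that edge, then each triangle spanned by \<open>p\<close> and an edge has area
  at least \<open>t\<close>, and these \<open>n\<close> triangles tile \<open>P\<close>. For \<open>n \<ge> 7\<close> any three edges miss a common vertex,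
  so Helly's theorem gives \<open>p\<close> (\<open>deep_point\<close>). A hexagon need not have such a point; there the three
  main diagonals and their pairwise intersections provide six disjoint triangles of area at least
  \<open>t\<close> (\<open>ears_le_hexagon\<close>).

  Upper bound \<open>4/n \<cdot> sin\<^sup>2(2\<pi>/n)\<close>. It is the smaller one only for \<open>n > 12\<close>. Enclose \<open>P\<close> in a rectangle
  with one side parallel to a diameter of \<open>P\<close>; its area is at most twice that of \<open>P\<close>. After scaling the
  rectangle to the unit square the perimeter of \<open>P\<close> is at most 4 and its exterior angles sum to \<open>2\<pi>\<close>.
  An ear is half the product of two consecutive side lengths and the sine of the angle between
  them, so the inequality of arithmetic and geometric means bounds the least ear by a multiple of
  \<open>1/n\<^sup>3\<close> times the area (\<open>turning_product_bound\<close>, \<open>min_ear_le_cubic\<close>).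

  Lower bound. Let \<open>Q\<close> be an \<open>(n - 1)\<close>-gon in the regular \<open>n\<close>-gon \<open>R\<close>. If the centre is not interior to
  \<open>Q\<close>, a line through the centre separates \<open>Q\<close> from one of the \<open>n\<close> central triangles of \<open>R\<close>
  (\<open>inscribed_beside_center\<close>). Otherwise the vertices of \<open>Q\<close> go once around the centre; pushing them
  radially onto the boundary of \<open>R\<close> and measuring position on the boundary by a parameter that grows
  by 1 along every edge of \<open>R\<close>, the area of the triangle over an edge of \<open>Q\<close> is bounded by an affine
  function of the parameter difference, namely the chord of \<open>sin\<close> through the arguments \<open>2\<pi>/n\<close> and
  \<open>4\<pi>/n\<close>. The differences sum to \<open>n\<close>, which yields the area of \<open>R\<close> without one ear
  (\<open>inscribed_around_center\<close>).
\<close>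

section \<open>Oriented area in the plane\<close>

definition cross2 :: "real^2 \<Rightarrow> real^2 \<Rightarrow> real" where
  "cross2 a b = a $ 1 * b $ 2 - a $ 2 * b $ 1"

text \<open>Twice the signed area of the triangle \<open>a b c\<close>; positive when it is traversed counterclockwise.\<close>

definition orient :: "real^2 \<Rightarrow> real^2 \<Rightarrow> real^2 \<Rightarrow> real" where
  "orient a b c = cross2 (b - a) (c - a)"

lemma orient_conv_cross2: "orient a b c = cross2 a b + cross2 b c + cross2 c a"
  by (simp add: orient_def cross2_def algebra_simps)

lemma cross2_skew: "cross2 b a = - cross2 a b"
  by (simp add: cross2_def)

lemma cross2_bilinear [simp]:
  "cross2 0 b = 0" "cross2 a 0 = 0" "cross2 a a = 0"
  "cross2 (c *\<^sub>R a) b = c * cross2 a b" "cross2 a (c *\<^sub>R b) = c * cross2 a b"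
  by (simp_all add: cross2_def algebra_simps)

lemma cross2_add:
  "cross2 (a + a') b = cross2 a b + cross2 a' b" "cross2 a (b + b') = cross2 a b + cross2 a b'"
  "cross2 (a - a') b = cross2 a b - cross2 a' b" "cross2 a (b - b') = cross2 a b - cross2 a b'"
  by (simp_all add: cross2_def algebra_simps)

lemma orient_rotate: "orient b c a = orient a b c"
  by (simp add: orient_def cross2_def algebra_simps)

lemma orient_swap: "orient a c b = - orient a b c"
  by (simp add: orient_def cross2_def algebra_simps)

lemma orient_degenerate [simp]: "orient a a b = 0" "orient a b a = 0" "orient a b b = 0"
  by (simp_all add: orient_def cross2_def algebra_simps)

lemma orient_affine:
  assumes "u + v = 1"
  shows "orient a b (u *\<^sub>R x + v *\<^sub>R y) = u * orient a b x + v * orient a b y"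
proof -
  have u: "u = 1 - v" using assms by simp
  show ?thesis unfolding u by (simp add: orient_def cross2_def algebra_simps)
qed

lemma real2_eq_iff: "(x = y) \<longleftrightarrow> x $ 1 = y $ 1 \<and> x $ 2 = (y::real^2) $ 2"
  by (simp add: vec_eq_iff forall_2)

lemma orient_halfplane:
  "convex {x. orient a b x \<ge> c}" "convex {x. orient a b x \<le> c}"
proof -
  have *: "u * c + v * c = c" if "u + v = 1" for u v :: real
    using that by (metis distrib_right mult_1)
  show "convex {x. orient a b x \<ge> c}" "convex {x. orient a b x \<le> c}"
    unfolding convex_def by (auto simp: orient_affine) 
      (metis * add_mono mult_left_mono)+
qed

lemma orient_hull_ge:
  assumes "x \<in> convex hull S" "\<And>y. y \<in> S \<Longrightarrow> orient a b y \<ge> c"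
  shows "orient a b x \<ge> c"
proof -
  have "convex hull S \<subseteq> {x. orient a b x \<ge> c}"
    by (rule hull_minimal) (use assms(2) orient_halfplane in auto)
  then show ?thesis using assms(1) by auto
qed

lemma cross2_inner: "cross2 a x = (\<chi> i. if i = 1 then - a $ 2 else a $ 1) \<bullet> x"
  by (simp add: cross2_def inner_vec_def sum_2)

lemma negligible_cross2_line:
  assumes "a \<noteq> 0" shows "negligible {x. cross2 a x = c}"
  unfolding cross2_inner
  by (rule negligible_hyperplane) (use assms in \<open>auto simp: vec_eq_iff forall_2\<close>)

lemma negligible_orient_line:
  assumes "a \<noteq> b" shows "negligible {x. orient a b x = c}"
proof -
  have "{x. orient a b x = c} = {x. cross2 (b - a) x = c + cross2 (b - a) a}"
    by (auto simp: orient_def cross2_add)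
  then show ?thesis using negligible_cross2_line[of "b - a"] assms by simp
qed

text \<open>The three orientations are the barycentric coordinates of \<open>x\<close>, up to the factor \<open>orient a b c\<close>.\<close>

lemma triangle_mem:
  assumes "orient a b c > 0" "orient a b x \<ge> 0" "orient b c x \<ge> 0" "orient c a x \<ge> 0"
  shows "x \<in> convex hull {a, b, c}"
proof -
  let ?D = "orient a b c"
  have "orient b c x + orient c a x + orient a b x = ?D"
    by (simp add: orient_def cross2_def algebra_simps)
  moreover have "?D *\<^sub>R x = orient b c x *\<^sub>R a + orient c a x *\<^sub>R b + orient a b x *\<^sub>R c"
    by (simp add: real2_eq_iff orient_def cross2_def algebra_simps)
  then have "x = (1 / ?D) *\<^sub>R (orient b c x *\<^sub>R a + orient c a x *\<^sub>R b + orient a b x *\<^sub>R c)"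
    using assms(1) by (metis less_irrefl nonzero_divide_eq_eq scaleR_one scaleR_scaleR)
  then have "x = (orient b c x / ?D) *\<^sub>R a + (orient c a x / ?D) *\<^sub>R b + (orient a b x / ?D) *\<^sub>R c"
    by (simp add: scaleR_add_right)
  ultimately show ?thesis unfolding convex_hull_3 using assms
    by (smt (verit, best) add_divide_distrib divide_nonneg_pos divide_self_if mem_Collect_eq)
qed

lemma area_triangle: "area (convex hull {a, b, c}) = \<bar>orient a b c\<bar> / 2"
proof -
  have "convex hull {a, b, c} \<in> sets lborel"
    by (simp add: borel_closed compact_imp_closed finite_imp_compact_convex_hull)
  then show ?thesis
    by (simp add: content_triangle orient_def cross2_def) (simp add: abs_minus_commute algebra_simps)
qed

lemma hull_lmeasurable: "finite S \<Longrightarrow> convex hull (S :: (real^2) set) \<in> lmeasurable"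
  by (simp add: finite_imp_compact_convex_hull lmeasurable_compact)

lemma area_Un_negligible:
  assumes "A \<in> lmeasurable" "B \<in> lmeasurable" "negligible (A \<inter> B)"
  shows "area (A \<union> B) = area A + area B"
  using measure_Un3[OF assms(1,2)] assms(3) by (simp add: negligible_imp_measure0)

section \<open>Area of a convex polygon\<close>

text \<open>Counterclockwise convex position, expressed on all triples so that sub-sequences inherit it.\<close>

definition chain :: "nat \<Rightarrow> (nat \<Rightarrow> real^2) \<Rightarrow> bool" where
  "chain m v \<longleftrightarrow> (\<forall>i j k. i < j \<longrightarrow> j < k \<longrightarrow> k < m \<longrightarrow> orient (v i) (v j) (v k) > 0)"

definition closed_sum :: "nat \<Rightarrow> (nat \<Rightarrow> real^2) \<Rightarrow> real" where
  "closed_sum m v = (\<Sum>i<m. cross2 (v i) (v (Suc i))) + cross2 (v m) (v 0)"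

text \<open>A point of the larger hull lies on a segment from the new vertex \<open>y\<close> to a point \<open>s\<close> of the old hull.
  The line through \<open>v 0\<close> and \<open>v m\<close> meets that segment inside the edge between these two vertices,
  since the whole polygon lies to the left of the two edges at \<open>y\<close>.\<close>

lemma hull_add_vertex:
  assumes ch: "chain (Suc (Suc m)) v" and m: "1 \<le> m"
  shows "convex hull (v ` {..Suc m}) = convex hull (v ` {..m}) \<union> convex hull {v 0, v m, v (Suc m)}"
proof (rule equalityI)
  let ?y = "v (Suc m)"
  let ?S = "v ` {..m}"
  have Tpos: "orient (v 0) (v m) ?y > 0"
    using ch m unfolding chain_def by auto
  have e1: "orient (v m) ?y z \<ge> 0" if "z \<in> convex hull (v ` {..Suc m})" for z
  proof (rule orient_hull_ge[OF that])
    fix w assume "w \<in> v ` {..Suc m}"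
    then obtain i where i: "i \<le> Suc m" "w = v i" by auto
    consider "i = Suc m" | "i = m" | "i < m" using i by linarith
    then show "orient (v m) ?y w \<ge> 0"
      using ch i(2) unfolding chain_def by cases (auto simp: orient_rotate intro: less_imp_le)
  qed
  have e2: "orient ?y (v 0) z \<ge> 0" if "z \<in> convex hull (v ` {..Suc m})" for z
  proof (rule orient_hull_ge[OF that])
    fix w assume "w \<in> v ` {..Suc m}"
    then obtain i where i: "i \<le> Suc m" "w = v i" by auto
    consider "i = Suc m" | "i = 0" | "0 < i" "i < Suc m" using i by linarith
    then show "orient ?y (v 0) w \<ge> 0"
      using ch i(2) orient_rotate[of "v 0" w ?y, symmetric] unfolding chain_def by cases (auto simp: less_imp_le)
  qed
  show "convex hull (v ` {..Suc m}) \<subseteq> convex hull ?S \<union> convex hull {v 0, v m, ?y}"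
  proof
    fix x assume x: "x \<in> convex hull (v ` {..Suc m})"
    show "x \<in> convex hull ?S \<union> convex hull {v 0, v m, ?y}"
    proof (cases "orient (v m) (v 0) x \<le> 0")
      case True
      then have "x \<in> convex hull {v 0, v m, ?y}"
        using triangle_mem[OF Tpos _ e1[OF x] e2[OF x]] by (simp add: orient_def cross2_def algebra_simps)
      then show ?thesis by simp
    next
      case False
      have "v ` {..Suc m} = insert ?y ?S" by (auto simp: atMost_Suc)
      moreover have "?S \<noteq> {}" by auto
      ultimately obtain u w s where us: "u \<ge> 0" "w \<ge> 0" "u + w = 1" "s \<in> convex hull ?S"
        "x = u *\<^sub>R ?y + w *\<^sub>R s"
        using x convex_hull_insert[of ?S ?y] by auto
      let ?f = "orient (v m) (v 0)"
      have fy: "?f ?y < 0" using Tpos orient_swap orient_rotate by (metis neg_less_0_iff_less)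
      have fx: "?f x = u * ?f ?y + w * ?f s" using us orient_affine by simp
      have "u * ?f ?y \<le> 0" using fy us(1) by (simp add: mult_nonneg_nonpos)
      then have "w * ?f s > 0" using False fx by linarith
      then have fs: "?f s > 0" using us(2) by (simp add: zero_less_mult_iff)
      \<comment> \<open>\<open>z\<close> is where the segment from \<open>s\<close> to the new vertex crosses the line.\<close>
      define l where "l = ?f s / (?f s - ?f ?y)"
      have l: "0 \<le> l" "l \<le> 1" using fs fy by (auto simp: l_def divide_simps)
      define z where "z = l *\<^sub>R ?y + (1 - l) *\<^sub>R s"
      have sP: "s \<in> convex hull (v ` {..Suc m})"
        using us(4) hull_mono[of ?S "v ` {..Suc m}"] by (meson atMost_subset_iff image_mono le_SucI order_refl subsetD)
      have yP: "?y \<in> convex hull (v ` {..Suc m})" by (simp add: hull_inc)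
      have zP: "z \<in> convex hull (v ` {..Suc m})" unfolding z_def
        using l sP yP by (intro convexD) auto
      have "?f z = l * ?f ?y + (1 - l) * ?f s" unfolding z_def by (simp add: orient_affine)
      then have fz: "?f z = 0" using fs fy by (simp add: l_def field_simps)
      have "z = (orient ?y (v 0) z / orient (v 0) (v m) ?y) *\<^sub>R v m + (orient (v m) ?y z / orient (v 0) (v m) ?y) *\<^sub>R v 0"
      proof -
        let ?D = "orient (v 0) (v m) ?y"
        have "?D *\<^sub>R z = orient ?y (v 0) z *\<^sub>R v m + orient (v m) ?y z *\<^sub>R v 0 + orient (v 0) (v m) z *\<^sub>R ?y"
          by (simp add: real2_eq_iff orient_def cross2_def algebra_simps)
        moreover have "orient (v 0) (v m) z = 0" using fz by (simp add: orient_def cross2_def algebra_simps)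
        ultimately have "?D *\<^sub>R z = orient ?y (v 0) z *\<^sub>R v m + orient (v m) ?y z *\<^sub>R v 0" by simp
        then have "z = (1/?D) *\<^sub>R (orient ?y (v 0) z *\<^sub>R v m + orient (v m) ?y z *\<^sub>R v 0)"
          using Tpos by (metis less_irrefl nonzero_divide_eq_eq scaleR_one scaleR_scaleR)
        then show ?thesis by (simp add: scaleR_add_right)
      qed
      moreover have "orient ?y (v 0) z / orient (v 0) (v m) ?y + orient (v m) ?y z / orient (v 0) (v m) ?y = 1"
      proof -
        have "orient ?y (v 0) z + orient (v m) ?y z + orient (v 0) (v m) z = orient (v 0) (v m) ?y"
          by (simp add: orient_def cross2_def algebra_simps)
        moreover have "orient (v 0) (v m) z = 0" using fz by (simp add: orient_def cross2_def algebra_simps)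
        ultimately show ?thesis using Tpos by (simp add: field_simps)
      qed
      moreover have "v m \<in> convex hull ?S" "v 0 \<in> convex hull ?S" by (simp_all add: hull_inc)
      moreover have "0 \<le> orient ?y (v 0) z / orient (v 0) (v m) ?y" "0 \<le> orient (v m) ?y z / orient (v 0) (v m) ?y"
        using e1[OF zP] e2[OF zP] Tpos by simp_all
      ultimately have zS: "z \<in> convex hull ?S"
        using convexD[OF convex_convex_hull, of "v m" ?S "v 0"] by metis
      have ul: "u \<le> l"
      proof -
        have "?f x = ?f s - u * (?f s - ?f ?y)" using fx us(3) by (simp add: algebra_simps) (metis distrib_left mult_1_right mult.commute)
        then have "u * (?f s - ?f ?y) < ?f s" using False by simp
        then show ?thesis using fs fy by (simp add: l_def field_simps)
      qed
      have "l > 0" using fs fy by (simp add: l_def)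
      have "x = (u / l) *\<^sub>R z + (1 - u / l) *\<^sub>R s"
      proof -
        have w: "w = 1 - u" using us by simp
        show ?thesis unfolding us(5) z_def w using \<open>l > 0\<close>
          by (simp add: real2_eq_iff field_simps)
      qed
      moreover have "0 \<le> u / l" "0 \<le> 1 - u / l" using ul \<open>l > 0\<close> us by auto
      ultimately have "x \<in> convex hull ?S"
        using convexD[of "convex hull ?S" z s "u / l" "1 - u / l"] zS us(4) by auto
      then show ?thesis by simp
    qed
  qed
  show "convex hull ?S \<union> convex hull {v 0, v m, ?y} \<subseteq> convex hull (v ` {..Suc m})"
    by (intro Un_least hull_mono) auto
qed

lemma area_chain:
  assumes "chain (Suc m) v"
  shows "area (convex hull (v ` {..m})) = closed_sum m v / 2"
  using assms
proof (induction m)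
  case 0
  then show ?case by (simp add: closed_sum_def)
next
  case (Suc m)
  show ?case
  proof (cases "m = 0")
    case True
    have "v ` {..Suc 0} = {v 0, v 1, v 1}" by (auto simp: atMost_Suc)
    then show ?thesis using True area_triangle[of "v 0" "v 1" "v 1"]
      by (simp add: closed_sum_def cross2_skew[of "v 0"])
  next
    case False
    let ?S = "v ` {..m}" and ?T = "{v 0, v m, v (Suc m)}"
    have IH: "area (convex hull ?S) = closed_sum m v / 2"
      using Suc unfolding chain_def by auto
    have Tpos: "orient (v 0) (v m) (v (Suc m)) > 0"
      using Suc.prems False unfolding chain_def by auto
    have ne: "v 0 \<noteq> v m" using Tpos by auto
    have "orient (v m) (v 0) x \<ge> 0" if "x \<in> convex hull ?S" for x
    proof (rule orient_hull_ge[OF that])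
      fix w assume "w \<in> ?S"
      then obtain i where i: "i \<le> m" "w = v i" by auto
      consider "i = 0" | "i = m" | "0 < i" "i < m" using i by linarith
      then show "orient (v m) (v 0) w \<ge> 0"
        using Suc.prems i(2) orient_rotate[of "v 0" w "v m", symmetric] unfolding chain_def
        by cases (auto simp: less_imp_le)
    qed
    moreover have "orient (v 0) (v m) x \<ge> 0" if "x \<in> convex hull ?T" for x
      by (rule orient_hull_ge[OF that]) (use Tpos in auto)
    ultimately have "convex hull ?S \<inter> convex hull ?T \<subseteq> {x. orient (v 0) (v m) x = 0}"
      by (auto simp: orient_def cross2_def algebra_simps) (smt (verit))
    then have "negligible (convex hull ?S \<inter> convex hull ?T)"
      using negligible_orient_line[OF ne] negligible_subset by blast
    then have "area (convex hull (v ` {..Suc m})) = area (convex hull ?S) + area (convex hull ?T)"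
      using hull_add_vertex[OF Suc.prems] False
      by (simp add: area_Un_negligible hull_lmeasurable)
    also have "\<dots> = closed_sum (Suc m) v / 2"
      using IH Tpos by (simp add: area_triangle closed_sum_def orient_conv_cross2 cross2_skew[of "v m" "v 0"] field_simps)
    finally show ?thesis .
  qed
qed

section \<open>Cyclically ordered convex polygons\<close>

text \<open>Periodic indexing makes the notion invariant under rotation (\<open>cycle_shift\<close>), so that any vertex may be
  taken as the first or the last one.\<close>

definition convex_cycle :: "nat \<Rightarrow> (nat \<Rightarrow> real^2) \<Rightarrow> bool" where
  "convex_cycle n v \<longleftrightarrow> (\<forall>i. v (i + n) = v i) \<and>
     (\<forall>i j k. i < j \<longrightarrow> j < k \<longrightarrow> k < i + n \<longrightarrow> orient (v i) (v j) (v k) > 0)"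

lemma cycle_period: "convex_cycle n v \<Longrightarrow> v (i + n) = v i"
  by (simp add: convex_cycle_def)

lemma cycle_pos:
  "convex_cycle n v \<Longrightarrow> i < j \<Longrightarrow> j < k \<Longrightarrow> k < i + n \<Longrightarrow> orient (v i) (v j) (v k) > 0"
  by (simp add: convex_cycle_def)

lemma cycle_period_mult: "convex_cycle n v \<Longrightarrow> v (i + n * k) = v i"
proof (induction k)
  case (Suc k)
  have "v (i + n * Suc k) = v ((i + n * k) + n)" by (simp add: algebra_simps)
  then show ?case using Suc cycle_period[OF Suc.prems, of "i + n * k"] by simp
qed simp

lemma cycle_mod: "convex_cycle n v \<Longrightarrow> v (i mod n) = v i"
  using cycle_period_mult[of n v "i mod n" "i div n"] by simp

lemma cycle_shift: "convex_cycle n v \<Longrightarrow> convex_cycle n (\<lambda>i. v (i + c))"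
  unfolding convex_cycle_def by (auto simp: ac_simps) (metis add.assoc add.commute)

lemma mod_index_from:
  assumes "n > (0::nat)"
  obtains k' where "i \<le> k'" "k' < i + n" "k' mod n = k mod n"
proof -
  define r where "r = (k + n * i - i) mod n"
  have "i \<le> k + n * i" using assms by (simp add: trans_le_add2)
  then have "(i + r) mod n = (k + n * i) mod n" unfolding r_def by (simp add: mod_add_right_eq)
  then have "(i + r) mod n = k mod n" by simp
  moreover have "r < n" using assms by (simp add: r_def)
  ultimately show ?thesis using that[of "i + r"] by simp
qed

lemma cycle_index_from:
  assumes v: "convex_cycle n v" and n: "n > 0"
  obtains k' where "i \<le> k'" "k' < i + n" "v k' = v k"
proof -
  obtain k' where k': "i \<le> k'" "k' < i + n" "k' mod n = k mod n" by (rule mod_index_from[OF n])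
  then have "v k' = v k" using cycle_mod[OF v] by metis
  then show ?thesis using that k' by blast
qed

lemma cycle_edge_nonneg:
  assumes "convex_cycle n v" "n \<ge> 2"
  shows "orient (v i) (v (Suc i)) (v k) \<ge> 0"
proof -
  obtain k' where k': "i \<le> k'" "k' < i + n" "v k' = v k" 
    using cycle_index_from[OF assms(1)] assms(2) by (metis less_le_trans pos2)
  consider "k' = i" | "k' = Suc i" | "Suc i < k'" using k'(1) by linarith
  then show ?thesis using k' cycle_pos[OF assms(1), of i "Suc i" k'] by cases (auto simp flip: k'(3))
qed

lemma cycle_image: 
  assumes "convex_cycle n v" "n > 0"
  shows "v ` {i..<i+n} = range v"
  by (auto, metis assms cycle_index_from imageI atLeastLessThan_iff)

lemma cycle_image_lessThan: "convex_cycle n v \<Longrightarrow> n > 0 \<Longrightarrow> v ` {..<n} = range v"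
  using cycle_image[of n v 0] by (simp add: lessThan_atLeast0)

lemma convex_cycle_of_chain:
  assumes "chain n v" "n > 0"
  shows "convex_cycle n (\<lambda>i. v (i mod n))"
  unfolding convex_cycle_def
proof (intro conjI allI impI)
  fix i j k assume ijk: "i < j" "j < k" "k < i + n"
  define q a where "q = i div n" and "a = i mod n"
  have i: "i = n * q + a" and a: "a < n" using assms by (auto simp: q_def a_def)
  obtain b where j: "j = n * q + b" using ijk(1) i by (metis add.assoc le_Suc_ex less_imp_le)
  obtain c where k: "k = n * q + c" using ijk i by (metis add.assoc le_Suc_ex less_imp_le less_trans)
  have abc: "a < b" "b < c" "c < a + n" using ijk i j k by auto
  have m: "i mod n = a" "j mod n = b mod n" "k mod n = c mod n" using i j k a by auto
  have ch: "0 < orient (v x) (v y) (v z)" if "x < y" "y < z" "z < n" for x y z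
    using assms that by (auto simp: chain_def)
  consider "c < n" | "b < n" "n \<le> c" | "n \<le> b" by linarith
  then show "0 < orient (v (i mod n)) (v (j mod n)) (v (k mod n))"
  proof cases
    case 1 then show ?thesis using m abc ch by simp
  next
    case 2
    then have "c mod n = c - n" using abc a by (simp add: mod_if)
    then show ?thesis using m 2 abc ch[of "c - n" a b] by (simp add: orient_rotate)
  next
    case 3
    then have "c mod n = c - n" "b mod n = b - n" using abc a by (simp_all add: mod_if)
    then show ?thesis using m 3 abc a ch[of "b - n" "c - n" a]
      by (simp add: orient_rotate[of _ _ "v a"])
  qed
qed (simp)

lemma chain_of_cycle: "convex_cycle n v \<Longrightarrow> chain n v"
  by (auto simp: chain_def convex_cycle_def)

text \<open>The shoelace sum, which is twice the area (\<open>area_cycle\<close>).\<close>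

definition cycle_area2 :: "nat \<Rightarrow> (nat \<Rightarrow> real^2) \<Rightarrow> real" where
  "cycle_area2 n v = (\<Sum>i<n. cross2 (v i) (v (Suc i)))"

lemma area_cycle:
  assumes "convex_cycle n v" "n > 0"
  shows "area (convex hull (range v)) = cycle_area2 n v / 2"
proof -
  obtain m where n: "n = Suc m" using assms(2) by (metis gr0_conv_Suc)
  have "range v = v ` {..m}" using cycle_image_lessThan[OF assms] by (simp add: n lessThan_Suc_atMost)
  moreover have "v (Suc m) = v 0" using cycle_period[OF assms(1), of 0] n by simp
  ultimately show ?thesis using area_chain[of m v] chain_of_cycle[OF assms(1)]
    by (simp add: n closed_sum_def cycle_area2_def)
qed

lemma cycle_lmeasurable:
  assumes "convex_cycle n v" "n > 0" shows "convex hull (range v) \<in> lmeasurable"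
  using hull_lmeasurable[of "v ` {..<n}"] cycle_image_lessThan[OF assms] by (metis finite_imageI finite_lessThan)

text \<open>The diagonal joining the two neighbours of a vertex separates it strictly from the remaining vertices.\<close>

lemma cycle_vertex_notin_hull:
  assumes v: "convex_cycle n v" and n: "n \<ge> 3"
  shows "v (Suc i) \<notin> convex hull (v ` {i+2..i+n})"
proof
  assume "v (Suc i) \<in> convex hull (v ` {i+2..i+n})"
  then have "orient (v i) (v (i+2)) (v (Suc i)) \<ge> 0"
  proof (rule orient_hull_ge)
    fix w assume "w \<in> v ` {i+2..i+n}"
    then obtain k where k: "i+2 \<le> k" "k \<le> i+n" "w = v k" by auto
    consider "k = i + 2" | "k = i + n" | "i+2 < k" "k < i + n" using k by linarith
    then show "orient (v i) (v (i+2)) w \<ge> 0"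
      using k(3) cycle_period[OF v, of i] cycle_pos[OF v, of i "i+2" k] by cases auto
  qed
  moreover have "orient (v i) (v (Suc i)) (v (i+2)) > 0" using cycle_pos[OF v, of i "Suc i" "i+2"] n by simp
  ultimately show False using orient_swap[of "v i" "v (Suc i)" "v (i+2)"] by simp
qed

lemma not_collinear_orient:
  assumes "orient a b c \<noteq> 0" shows "\<not> collinear {a, b, c}"
proof
  assume "collinear {a, b, c}"
  then obtain u where u: "\<And>x y. x \<in> {a,b,c} \<Longrightarrow> y \<in> {a,b,c} \<Longrightarrow> \<exists>t. x - y = t *\<^sub>R u"
    unfolding collinear_def by blast
  obtain s where "b - a = s *\<^sub>R u" using u[of b a] by auto
  moreover obtain t where "c - a = t *\<^sub>R u" using u[of c a] by auto
  ultimately show False using assms by (simp add: orient_def)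
qed

lemma convex_ngon_of_cycle:
  assumes v: "convex_cycle n v" and n: "n \<ge> 3"
  shows "convex_ngon n (convex hull (range v))"
proof -
  let ?P = "convex hull (range v)"
  have rng: "range v = v ` {..<n}" using cycle_image_lessThan[OF v] n by simp
  have fin: "finite (range v)" using rng by simp
  have others: "\<exists>i. x = v (Suc i) \<and> range v - {x} \<subseteq> v ` {i+2..i+n}" if "x \<in> range v" for x
  proof -
    from that obtain k where k: "x = v k" by blast
    obtain i where i: "v (Suc i) = x" using cycle_period[OF v, of k] n k
      by (metis add_Suc_right gr0_conv_Suc less_le_trans zero_less_numeral)
    have "v ` {Suc i..<Suc i + n} = range v" using cycle_image[OF v, of "Suc i"] n by simp
    moreover have "{Suc i..<Suc i + n} = insert (Suc i) {i+2..i+n}" using n by auto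
    ultimately have "range v = insert x (v ` {i+2..i+n})" using i by (metis image_insert)
    then show ?thesis using i by blast
  qed
  have ext: "{x. x extreme_point_of ?P} = range v"
  proof -
    have "a \<notin> convex hull (range v - {a})" if "a \<in> range v" for a
      using others[OF that] cycle_vertex_notin_hull[OF v n] hull_mono by blast
    then show ?thesis using extreme_point_of_convex_hull_convex_independent[of "range v"] fin
      by (simp add: finite_imp_compact)
  qed
  have inj: "inj_on v {..<n}"
  proof (rule linorder_inj_onI)
    fix i j assume ij: "i < j" "i \<in> {..<n}" "j \<in> {..<n}"
    obtain k where "i < k \<and> k < j \<or> j < k \<and> k < i + n"
      using that[of "Suc i"] that[of "Suc j"] ij n by (cases "Suc i < j") auto
    then show "v i \<noteq> v j"
      using cycle_pos[OF v, of i k j] cycle_pos[OF v, of i j k] ij by auto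
  qed auto
  have "card (range v) = n" using card_image[OF inj] rng by simp
  moreover have "aff_dim ?P = 2"
  proof -
    have "orient (v 0) (v 1) (v 2) > 0" using cycle_pos[OF v, of 0 1 2] n by simp
    then have "\<not> collinear {v 0, v 1, v 2}" using not_collinear_orient by (metis less_irrefl)
    then have "\<not> aff_dim {v 0, v 1, v 2} \<le> 1" using collinear_aff_dim by blast
    moreover have "aff_dim {v 0, v 1, v 2} \<le> aff_dim (range v)" by (intro aff_dim_subset) auto
    moreover have "aff_dim (range v) \<le> 2" using aff_dim_le_DIM[of "range v"] by simp
    ultimately show ?thesis by (simp add: aff_dim_convex_hull)
  qed
  ultimately show ?thesis unfolding convex_ngon_def using polytope_convex_hull[OF fin] ext by simp
qed

text \<open>If two points lie on one ray from \<open>o'\<close>, the nearer one is in the segment from \<open>o'\<close> to the farther one.\<close>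

lemma convex_independent_not_collinear:
  assumes indep: "\<And>x. x \<in> V \<Longrightarrow> x \<notin> convex hull (V - {x})"
    and V: "o' \<in> V" "x \<in> V" "y \<in> V" "x \<noteq> y" "x \<noteq> o'" "y \<noteq> o'"
    and pos: "a \<bullet> (x - o') > 0" "a \<bullet> (y - o') > 0"
  shows "orient o' x y \<noteq> 0"
proof
  assume z: "orient o' x y = 0"
  have between: "q \<in> convex hull (V - {q})" if "q = o' + t *\<^sub>R (p - o')" "0 \<le> t" "t \<le> 1" 
      "p \<in> V" "q \<noteq> p" "q \<noteq> o'" for p q t
  proof -
    have "q = (1 - t) *\<^sub>R o' + t *\<^sub>R p" using that by (simp add: algebra_simps)
    moreover have "o' \<in> convex hull (V - {q})" "p \<in> convex hull (V - {q})"
      using that V by (auto intro!: hull_inc)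
    ultimately show ?thesis using convexD[OF convex_convex_hull, of o' "V - {q}" p "1 - t" t] that by simp
  qed
  let ?p = "x - o'" and ?q = "y - o'"
  have par: "(a \<bullet> ?p) *\<^sub>R ?q = (a \<bullet> ?q) *\<^sub>R ?p"
    using z unfolding real2_eq_iff orient_def cross2_def by (simp add: inner_vec_def sum_2) algebra
  define t where "t = (a \<bullet> ?q) / (a \<bullet> ?p)"
  have t: "t > 0" using pos by (simp add: t_def)
  have "?q = t *\<^sub>R ?p"
  proof -
    have "(1 / (a \<bullet> ?p)) *\<^sub>R ((a \<bullet> ?p) *\<^sub>R ?q) = (1 / (a \<bullet> ?p)) *\<^sub>R ((a \<bullet> ?q) *\<^sub>R ?p)" using par by simp
    then show ?thesis using pos by (simp add: t_def)
  qed
  then have y: "y = o' + t *\<^sub>R (x - o')" by (metis add_diff_cancel_left' diff_add_cancel add.commute)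
  have x: "x = o' + (1 / t) *\<^sub>R (y - o')" using t by (simp add: y)
  show False
  proof (cases "t \<le> 1")
    case True then show ?thesis using between[OF y] t V indep by auto
  next
    case False then show ?thesis using between[OF x] t V indep by auto
  qed
qed

text \<open>A vertex \<open>p\<close> is strictly separated from the others, so all others are seen from \<open>p\<close> within an open
  half-plane with inner normal \<open>a\<close>. There the slope relative to \<open>a\<close> is a sorting key, and comparing two keys
  is the same as taking the orientation of the two points with \<open>p\<close>. A triple of later points in the
  wrong orientation would put its middle point into the triangle of \<open>p\<close> and the two others.\<close>

lemma cycle_of_convex_ngon:
  assumes P: "convex_ngon n P" and n: "n \<ge> 3"
  obtains v where "convex_cycle n v" "P = convex hull (range v)"
proof -
  define V where "V = {x. x extreme_point_of P}"
  have fin: "finite V" using P n unfolding V_def convex_ngon_def by (metis card.infinite not_numeral_le_zero)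
  have card: "card V = n" using P by (simp add: convex_ngon_def V_def)
  have cP: "compact P" "convex P" using P by (auto simp: convex_ngon_def polytope_imp_compact polytope_imp_convex)
  then have PV: "P = convex hull V" unfolding V_def by (rule Krein_Milman_Minkowski)
  have indep: "x \<notin> convex hull (V - {x})" if "x \<in> V" for x
  proof -
    have "x extreme_point_of P" using that by (simp add: V_def)
    then have "convex (P - {x})" using extreme_point_of_stillconvex[OF cP(2)] by blast
    moreover have "V - {x} \<subseteq> P - {x}" using PV hull_subset[of V convex] by auto
    ultimately have "convex hull (V - {x}) \<subseteq> P - {x}" by (intro hull_minimal)
    then show ?thesis by auto
  qed
  have "V \<noteq> {}" using card n by auto
  then obtain p where p: "p \<in> V" by auto
  define S where "S = V - {p}"
  have Sfin: "finite S" "card S = n - 1" using fin p card by (auto simp: S_def)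
  have clos: "closed (convex hull S)" using Sfin by (simp add: finite_imp_compact_convex_hull compact_imp_closed)
  obtain a b where ab: "a \<bullet> p < b" "\<And>x. x \<in> convex hull S \<Longrightarrow> a \<bullet> x > b"
    using separating_hyperplane_closed_point[OF convex_convex_hull clos, of p] indep[OF p] unfolding S_def by blast
  have pos: "a \<bullet> (x - p) > 0" if "x \<in> S" for x
    using ab(1) ab(2)[OF hull_inc[OF that]] by (simp add: inner_diff_right)
  define key where "key x = cross2 a (x - p) / (a \<bullet> (x - p))" for x
  have nrm: "(a \<bullet> u) * cross2 a w - (a \<bullet> w) * cross2 a u = (a \<bullet> a) * cross2 u w" for u w
    by (simp add: cross2_def inner_vec_def sum_2 algebra_simps)
  have apos: "a \<bullet> a > 0" 
  proof -
    have "S \<noteq> {}" using Sfin n by auto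
    then show ?thesis using pos by force
  qed
  have key_less: "key x < key y \<longleftrightarrow> orient p x y > 0" if "x \<in> S" "y \<in> S" for x y
  proof -
    have "key x < key y \<longleftrightarrow> (a \<bullet> a) * cross2 (x - p) (y - p) > 0"
      using pos[OF that(1)] pos[OF that(2)] unfolding nrm[symmetric]
      by (simp add: key_def divide_simps mult.commute)
    then show ?thesis using apos by (simp add: orient_def zero_less_mult_iff)
  qed
  have inj: "inj_on key S"
  proof (rule inj_onI, rule ccontr)
    fix x y assume xy: "x \<in> S" "y \<in> S" "key x = key y" "x \<noteq> y"
    then have "orient p x y \<le> 0" "orient p y x \<le> 0" using key_less[of x y] key_less[of y x] by auto
    then have "orient p x y = 0" using orient_swap[of p x y] by simp
    then show False using convex_independent_not_collinear[OF indep p _ _ _ _ _ pos pos] xy by (auto simp: S_def)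
  qed
  define ks where "ks = sorted_list_of_set (key ` S)"
  have ks: "set ks = key ` S" "length ks = n - 1" 
    using Sfin card_image[OF inj] by (auto simp: ks_def)
  have ks_less: "ks ! i < ks ! j" if "i < j" "j < n - 1" for i j
    using strict_sorted_list_of_set[of "key ` S"] that ks(2) unfolding ks_def
    by (simp add: sorted_wrt_nth_less)
  define w where "w i = (if i = 0 then p else the_inv_into S key (ks ! (i - 1)))" for i
  have wS: "w i \<in> S" "key (w i) = ks ! (i - 1)" if "0 < i" "i < n" for i
  proof -
    have "ks ! (i - 1) \<in> key ` S" using that ks by (metis One_nat_def diff_less_mono nth_mem Suc_leI)
    then show "w i \<in> S" "key (w i) = ks ! (i - 1)"
      using that the_inv_into_into[OF inj _ order_refl] f_the_inv_into_f[OF inj] by (auto simp: w_def)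
  qed
  have key_w: "key (w i) < key (w j)" if "0 < i" "i < j" "j < n" for i j
    using wS(2)[of i] wS(2)[of j] ks_less[of "i - 1" "j - 1"] that by simp
  have img: "w ` {..<n} = V"
  proof
    show "w ` {..<n} \<subseteq> V" using wS(1) p by (auto simp: S_def w_def)
    have "x \<in> w ` {..<n}" if "x \<in> S" for x
    proof -
      have "key x \<in> set ks" using ks that by auto
      then obtain i where i: "i < n - 1" "ks ! i = key x" using ks(2) by (auto simp: in_set_conv_nth)
      then have "w (Suc i) = x" using the_inv_into_f_f[OF inj that] by (simp add: w_def)
      then show ?thesis using i by (metis imageI lessThan_iff less_diff_conv Suc_eq_plus1)
    qed
    moreover have "p \<in> w ` {..<n}" using n by (intro image_eqI[of _ _ 0]) (auto simp: w_def)
    ultimately show "V \<subseteq> w ` {..<n}" by (auto simp: S_def)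
  qed
  have ch: "chain n w"
    unfolding chain_def
  proof (intro allI impI)
    fix i j k assume ijk: "i < j" "j < k" "k < n"
    have base: "orient p (w x) (w y) > 0" if "0 < x" "x < y" "y < n" for x y
      using key_less[of "w x" "w y"] key_w[OF that] wS(1)[of x] wS(1)[of y] that by simp
    show "0 < orient (w i) (w j) (w k)"
    proof (cases "i = 0")
      case True
      then show ?thesis using base[of j k] ijk by (simp add: w_def)
    next
      case False
      show ?thesis
      proof (rule ccontr)
        assume "\<not> ?thesis"
        then have "orient (w i) (w k) (w j) \<ge> 0" using orient_swap[of "w i" "w j" "w k"] by simp
        moreover have "orient (w k) p (w j) > 0" 
          using base[of j k] ijk False by (simp add: orient_rotate)
        ultimately have "w j \<in> convex hull {p, w i, w k}"
          using triangle_mem[of p "w i" "w k" "w j"] base[of i k] base[of i j] ijk False by auto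
        moreover have "{p, w i, w k} \<subseteq> V - {w j}"
          using key_w[of i j] key_w[of j k] wS(1)[of i] wS(1)[of j] wS(1)[of k] ijk False p
          by (auto simp: S_def)
        then have "convex hull {p, w i, w k} \<subseteq> convex hull (V - {w j})" by (rule hull_mono)
        ultimately show False using indep[of "w j"] wS(1)[of j] ijk by (auto simp: S_def)
      qed
    qed
  qed
  have cyc: "convex_cycle n (\<lambda>i. w (i mod n))" using convex_cycle_of_chain[OF ch] n by simp
  have "range (\<lambda>i. w (i mod n)) = V" using cycle_image_lessThan[OF cyc] n img by (metis (no_types, lifting) image_cong lessThan_iff mod_less less_le_trans zero_less_numeral)
  then show ?thesis using that cyc PV by metis
qed

text \<open>Rotating the indices makes \<open>v (i + 1)\<close> the last vertex; dropping it removes one triangle from the shoelace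
  sum.\<close>

lemma ear_removal:
  assumes v: "convex_cycle n v" and n: "n \<ge> 4"
  obtains Q where "convex_ngon (n - 1) Q" "Q \<subseteq> convex hull (range v)"
    "area Q = area (convex hull (range v)) - orient (v i) (v (i+1)) (v (i+2)) / 2"
proof -
  define w where "w j = v (j + (i + 2))" for j
  define m where "m = n - 2"
  then have m: "n = Suc (Suc m)" using n by simp
  have w: "convex_cycle n w" unfolding w_def by (rule cycle_shift[OF v])
  have wr: "range w = range v"
  proof
    show "range v \<subseteq> range w"
    proof
      fix x assume "x \<in> range v"
      then obtain k where "x = v k" by blast
      moreover obtain k' where "i + 2 \<le> k'" "v k' = v k" using cycle_index_from[OF v, of "i + 2" k] n by (metis gr0I not_numeral_le_zero)
      moreover have "v k' = w (k' - (i + 2))" using calculation(2) unfolding w_def by (metis le_add_diff_inverse2)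
      ultimately show "x \<in> range w" by (metis rangeI)
    qed
  qed (auto simp: w_def)
  have chn: "chain (Suc (Suc m)) w" using chain_of_cycle[OF w] m by simp
  then have ch: "chain (Suc m) w" by (auto simp: chain_def)
  define u where "u j = w (j mod Suc m)" for j
  have u: "convex_cycle (Suc m) u" unfolding u_def by (rule convex_cycle_of_chain[OF ch]) simp
  have ur: "range u = w ` {..m}" 
    using cycle_image_lessThan[OF u] by (simp add: u_def lessThan_Suc_atMost)
  let ?Q = "convex hull (range u)"
  have 1: "convex_ngon (n - 1) ?Q" using convex_ngon_of_cycle[OF u] m n by simp
  have 2: "?Q \<subseteq> convex hull (range v)" unfolding ur wr[symmetric] by (intro hull_mono) auto
  have 3: "area ?Q = closed_sum m w / 2" unfolding ur by (rule area_chain[OF ch])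
  have "range v = w ` {..Suc m}" using cycle_image_lessThan[OF w] m wr by (simp add: lessThan_Suc_atMost)
  then have 4: "area (convex hull (range v)) = closed_sum (Suc m) w / 2" using area_chain[OF chn] by simp
  have wv: "w m = v i" "w (Suc m) = v (i + 1)" "w 0 = v (i + 2)"
    using cycle_period[OF v, of i] cycle_period[OF v, of "i + 1"] m by (simp_all add: w_def ac_simps)
  have "area ?Q = area (convex hull (range v)) - orient (w m) (w (Suc m)) (w 0) / 2"
    unfolding 3 4 by (simp add: closed_sum_def orient_conv_cross2 cross2_skew[of "w m" "w 0"] field_simps)
  then show ?thesis using that[of ?Q] 1 2 wv by simp
qed

section \<open>Winding of closed sequences of vectors\<close>

definition dir :: "real \<Rightarrow> real^2" where
  "dir t = vector [cos t, sin t]"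

lemma dir_nth [simp]: "dir t $ 1 = cos t" "dir t $ 2 = sin t"
  by (simp_all add: dir_def)

lemma cross2_dir [simp]: "cross2 (dir s) (dir t) = sin (t - s)"
  by (simp add: cross2_def sin_diff)

lemma dir_periodic: "dir (t + 2 * pi) = dir t"
  by (simp add: real2_eq_iff)

lemma polar_form:
  obtains t where "0 \<le> t" "t < 2 * pi" "x = norm x *\<^sub>R dir t"
proof (cases "x = 0")
  case True then show ?thesis using that[of 0] by simp
next
  case False
  have nz: "norm x > 0" using False by simp
  have "(norm x)\<^sup>2 = (x $ 1)\<^sup>2 + (x $ 2)\<^sup>2"
    unfolding power2_norm_eq_inner by (simp add: inner_vec_def sum_2 power2_eq_square)
  then have "((x $ 1)\<^sup>2 + (x $ 2)\<^sup>2) / (norm x)\<^sup>2 = 1"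
    using nz by (metis divide_self less_irrefl power_not_zero)
  then have "(x $ 1 / norm x)\<^sup>2 + (x $ 2 / norm x)\<^sup>2 = 1"
    by (simp add: power_divide add_divide_distrib)
  then obtain t where t: "0 \<le> t" "t < 2 * pi" "x $ 1 / norm x = cos t" "x $ 2 / norm x = sin t"
    using sincos_total_2pi by blast
  have "norm x * (y / norm x) = y" for y using nz by simp
  then have "x = norm x *\<^sub>R dir t" by (simp add: real2_eq_iff flip: t(3,4))
  then show ?thesis using that[of t] t(1,2) by blast
qed

lemma sin_pos_imp:
  assumes "sin x > 0" "-pi \<le> x" "x \<le> 2 * pi" shows "0 < x" "x < pi"
proof -
  show "0 < x"
  proof (rule ccontr)
    assume "\<not> 0 < x"
    then have "sin (-x) \<ge> 0" using assms by (intro sin_ge_zero) auto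
    then show False using assms by simp
  qed
  show "x < pi"
  proof (rule ccontr)
    assume "\<not> x < pi"
    then have "sin (2 * pi - x) \<ge> 0" using assms by (intro sin_ge_zero) auto
    then show False using assms by (simp add: sin_diff)
  qed
qed

text \<open>Each step turns left by less than \<open>\<pi>\<close>, so the total turn is a positive multiple of \<open>2\<pi>\<close>. The last
  hypothesis says that the sequence never returns to the left of \<open>u 0\<close> once it has left that side, which
  excludes a second turn. The angles are taken in the interval of length \<open>2\<pi>\<close> that starts at the
  angle of \<open>u 0\<close>.\<close>

lemma turning_angles:
  fixes u :: "nat \<Rightarrow> real^2"
  assumes m: "0 < m" and closed: "u m = u 0"
    and pos: "\<And>i. i < m \<Longrightarrow> cross2 (u i) (u (Suc i)) > 0"
    and once: "\<And>i. 0 < i \<Longrightarrow> Suc i < m \<Longrightarrow> cross2 (u 0) (u i) \<le> 0 \<Longrightarrow> cross2 (u 0) (u (Suc i)) < 0"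
  obtains \<phi> where "0 \<le> \<phi> 0" "\<phi> m = \<phi> 0 + 2 * pi"
    "\<And>i. i \<le> m \<Longrightarrow> u i = norm (u i) *\<^sub>R dir (\<phi> i)"
    "\<And>i. i < m \<Longrightarrow> \<phi> i < \<phi> (Suc i) \<and> \<phi> (Suc i) < \<phi> i + pi"
proof -
  have "\<forall>i. \<exists>t. 0 \<le> t \<and> t < 2 * pi \<and> u i = norm (u i) *\<^sub>R dir t"
    using polar_form by metis
  then obtain \<beta> where \<beta>: "\<And>i. 0 \<le> \<beta> i" "\<And>i. \<beta> i < 2 * pi" "\<And>i. u i = norm (u i) *\<^sub>R dir (\<beta> i)"
    by metis
  define \<phi> where "\<phi> i = (if i = m then \<beta> 0 + 2 * pi else if \<beta> i \<ge> \<beta> 0 then \<beta> i else \<beta> i + 2 * pi)" for i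
  define a where "a i = \<phi> i - \<phi> 0" for i
  have \<phi>0: "\<phi> 0 = \<beta> 0" using m by (simp add: \<phi>_def)
  have rep: "u i = norm (u i) *\<^sub>R dir (\<phi> i)" for i
    using \<beta>(3)[of i] \<beta>(3)[of 0] closed by (auto simp: \<phi>_def dir_periodic)
  have cr: "cross2 (u i) (u j) = norm (u i) * norm (u j) * sin (\<phi> j - \<phi> i)" for i j
    by (subst rep[of i], subst rep[of j]) simp
  have nz: "norm (u i) > 0" if "i < m" for i using pos[OF that] by auto
  have nz': "norm (u i) > 0" if "i \<le> m" for i using nz[of i] nz[of 0] that closed m by (cases "i = m") auto
  have sgn: "cross2 (u i) (u j) > 0 \<longleftrightarrow> sin (a j - a i) > 0" if "i \<le> m" "j \<le> m" for i j
    unfolding cr a_def zero_less_mult_iff[of "_ * _"]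
    using mult_pos_pos[OF nz'[OF that(1)] nz'[OF that(2)]] by auto
  have sgn0: "cross2 (u 0) (u i) > 0 \<longleftrightarrow> sin (a i) > 0" if "i \<le> m" for i
    using sgn[of 0 i] that by (simp add: a_def)
  have range: "0 \<le> a i" "a i < 2 * pi" if "i < m" for i
    using that \<beta>(1,2)[of i] \<beta>(1,2)[of 0] \<phi>0 by (auto simp: a_def \<phi>_def)
  have am: "a m = 2 * pi" using \<phi>0 by (simp add: a_def) (simp add: \<phi>_def)
  have anz: "a i \<noteq> 0" if "0 < i" "i < m" for i
  proof
    assume "a i = 0"
    then have c: "cross2 (u 0) (u i) = 0" by (simp add: cr a_def)
    have s: "sin (a (Suc i)) > 0" using sgn[of i "Suc i"] pos[of i] that \<open>a i = 0\<close> by simp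
    show False
    proof (cases "Suc i < m")
      case True then show ?thesis using once[of i] sgn0[of "Suc i"] s that c by simp
    next
      case False
      then have "Suc i = m" using that by simp
      then show ?thesis using s am by simp
    qed
  qed
  have low: "a i < pi" if "i < m" "cross2 (u 0) (u i) > 0" for i
    using sin_pos_imp[of "a i"] sgn0[of i] range[OF that(1)] that by (simp add: less_imp_le)
  have high: "pi \<le> a i" if "0 < i" "i < m" "cross2 (u 0) (u i) \<le> 0" for i
  proof (rule ccontr)
    assume "\<not> pi \<le> a i"
    then have "sin (a i) > 0" using anz[of i] range(1)[of i] that by (intro sin_gt_zero) auto
    then show False using sgn0[of i] that by simp
  qed
  have step: "0 < a (Suc i) - a i \<and> a (Suc i) - a i < pi" if i: "i < m" for i
  proof -
    have s: "sin (a (Suc i) - a i) > 0" using sgn[of i "Suc i"] pos[OF i] i by simp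
    have "-pi \<le> a (Suc i) - a i \<and> a (Suc i) - a i \<le> 2 * pi"
    proof (cases "Suc i = m")
      case True then show ?thesis using am range[OF i] by simp
    next
      case False
      then have Si: "Suc i < m" using i by simp
      consider "i = 0" | "0 < i" "cross2 (u 0) (u i) > 0" | "0 < i" "cross2 (u 0) (u i) \<le> 0" by linarith
      then show ?thesis
      proof cases
        case 1 then show ?thesis using range[OF Si] by (simp add: a_def)
      next
        case 2 then show ?thesis using range[OF Si] range[OF i] low[OF i] by simp
      next
        case 3
        then have "cross2 (u 0) (u (Suc i)) < 0" using once[of i] Si by simp
        then show ?thesis using high[of "Suc i"] high[of i] range[OF Si] range[OF i] 3 Si i by simp
      qed
    qed
    then show ?thesis using sin_pos_imp[OF s] by simp
  qed
  show ?thesis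
  proof (rule that[of \<phi>])
    show "0 \<le> \<phi> 0" using \<phi>0 \<beta>(1) by simp
    show "\<phi> m = \<phi> 0 + 2 * pi" using am by (simp add: a_def)
    show "u i = norm (u i) *\<^sub>R dir (\<phi> i)" for i by (rule rep)
    show "\<phi> i < \<phi> (Suc i) \<and> \<phi> (Suc i) < \<phi> i + pi" if "i < m" for i
      using step[OF that] by (simp add: a_def)
  qed
qed

section \<open>The regular polygon\<close>

definition regular :: "nat \<Rightarrow> nat \<Rightarrow> real^2" where
  "regular n k = dir (real k * (2 * pi / real n))"

lemma orient_dir:
  "orient (dir a) (dir (a + 2 * x)) (dir (a + 2 * x + 2 * y)) = 4 * sin x * sin y * sin (x + y)"
proof -
  have "orient (dir a) (dir (a + 2 * x)) (dir (a + 2 * x + 2 * y)) = sin (2 * x) + sin (2 * y) - sin (2 * x + 2 * y)"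
    unfolding orient_conv_cross2 cross2_dir using sin_minus[of "2 * x + 2 * y"] by (simp add: algebra_simps)
  also have "\<dots> = 4 * sin x * sin y * sin (x + y)"
  proof -
    have "cos x * cos x = 1 - sin x * sin x" "cos y * cos y = 1 - sin y * sin y"
      using sin_cos_squared_add[of x] sin_cos_squared_add[of y] by (simp_all add: power2_eq_square algebra_simps)
    then show ?thesis unfolding sin_add cos_add sin_double cos_double power2_eq_square by algebra
  qed
  finally show ?thesis .
qed

lemma regular_cycle:
  assumes n: "n \<ge> 3" shows "convex_cycle n (regular n)"
  unfolding convex_cycle_def
proof (intro conjI allI impI)
  fix i show "regular n (i + n) = regular n i"
    using n dir_periodic[of "real i * (2 * pi / real n)"]
    by (simp add: regular_def distrib_right add_divide_distrib)
next
  fix i j k assume ijk: "i < j" "j < k" "k < i + n"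
  define x where "x = (real j - real i) * (pi / n)"
  define y where "y = (real k - real j) * (pi / n)"
  have "regular n j = dir (real i * (2 * pi / n) + 2 * x)"
    "regular n k = dir (real i * (2 * pi / n) + 2 * x + 2 * y)"
    by (simp_all add: regular_def x_def y_def algebra_simps add_divide_distrib diff_divide_distrib)
  then have o: "orient (regular n i) (regular n j) (regular n k) = 4 * sin x * sin y * sin (x + y)"
    using orient_dir by (simp add: regular_def)
  have "x > 0" "y > 0" using ijk n by (simp_all add: x_def y_def)
  moreover have "x + y = (real k - real i) * (pi / n)" by (simp add: x_def y_def algebra_simps)
  moreover have "(real k - real i) * (pi / n) < real n * (pi / n)"
    using ijk n by (intro mult_strict_right_mono) auto
  then have "(real k - real i) * (pi / n) < pi" using n by simp
  ultimately have "sin x > 0" "sin y > 0" "sin (x + y) > 0" by (auto intro!: sin_gt_zero)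
  then show "orient (regular n i) (regular n j) (regular n k) > 0" unfolding o by simp
qed

lemma cross2_regular:
  "cross2 (regular n i) (regular n j) = sin ((real j - real i) * (2 * pi / n))"
  by (simp add: regular_def algebra_simps diff_divide_distrib)

lemma regular_area2: "cycle_area2 n (regular n) = real n * sin (2 * pi / n)"
  by (simp add: cycle_area2_def cross2_regular)

text \<open>Two consecutive vertices around the antipode of the first vertex form with it a triangle that contains the centre.\<close>

lemma zero_in_regular:
  assumes n: "n \<ge> 3" shows "0 \<in> convex hull (range (regular n))"
proof -
  define a where "a = n div 2"
  have a: "0 < a" "Suc a < n" "2 * a \<le> n" "n \<le> 2 * Suc a" using n by (auto simp: a_def)
  have half: "0 \<le> sin (real k * (2 * pi / n))" if "2 * k \<le> n" for k
  proof (rule sin_ge_zero)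
    have "real (2 * k) * (pi / n) \<le> real n * (pi / n)" using that by (intro mult_right_mono) auto
    then show "real k * (2 * pi / real n) \<le> pi" using n by (simp add: ac_simps)
  qed simp
  have "cross2 (regular n (Suc a)) (regular n 0) = cross2 (regular n (Suc a)) (regular n n)"
    using cycle_period[OF regular_cycle[OF n], of 0] by simp
  also have "\<dots> = sin (real (n - Suc a) * (2 * pi / n))" using a by (simp add: cross2_regular of_nat_diff)
  finally have 3: "0 \<le> cross2 (regular n (Suc a)) (regular n 0)" using half[of "n - Suc a"] a by simp
  have 1: "0 \<le> cross2 (regular n 0) (regular n a)" using half[of a] a by (simp add: cross2_regular)
  have 2: "0 \<le> cross2 (regular n a) (regular n (Suc a))" using half[of 1] n by (simp add: cross2_regular)
  have "0 \<in> convex hull {regular n 0, regular n a, regular n (Suc a)}"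
    using triangle_mem[of "regular n 0" "regular n a" "regular n (Suc a)" 0] 1 2 3 a
      cycle_pos[OF regular_cycle[OF n], of 0 a "Suc a"] by (simp add: orient_conv_cross2)
  then show ?thesis using hull_mono[of "{regular n 0, regular n a, regular n (Suc a)}" "range (regular n)"] by auto
qed

text \<open>The differences \<open>sin ((d + 1) \<theta>) - sin (d \<theta>)\<close> are \<open>2 sin (\<theta>/2) cos ((d + 1/2) \<theta>)\<close>, and among \<open>1 \<le> d \<le> n - 2\<close>
  the cosine is largest at \<open>d = 1\<close>.\<close>

lemma sin_chord_nat:
  assumes "n \<ge> 3" "1 \<le> d" "d \<le> n - 1"
  shows "sin (real d * (2 * pi / n)) \<le> sin (2 * pi / n) + (real d - 1) * (sin (2 * (2 * pi / n)) - sin (2 * pi / n))"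
  using assms(2,3)
proof (induction d rule: dec_induct)
  case base then show ?case by simp
next
  case (step d)
  define \<theta> where "\<theta> = 2 * pi / n"
  have n\<theta>: "real n * \<theta> = 2 * pi" using assms(1) by (simp add: \<theta>_def)
  have \<theta>: "0 < \<theta>" using assms(1) by (simp add: \<theta>_def)
  have diff: "sin (y + \<theta>) - sin y = 2 * sin (\<theta> / 2) * cos (y + \<theta> / 2)" for y
    using sin_diff_sin[of "y + \<theta>" y] by (simp add: algebra_simps add_divide_distrib)
  define z where "z = real d * \<theta> + \<theta> / 2"
  have z1: "3 * \<theta> / 2 \<le> z"
    using step.hyps(1) \<theta> mult_right_mono[of 1 "real d" \<theta>] by (simp add: z_def)
  have "real d * \<theta> \<le> (real n - 2) * \<theta>" using step.prems \<theta> by (intro mult_right_mono) auto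
  then have z2: "z \<le> 2 * pi - 3 * \<theta> / 2" using n\<theta> by (simp add: z_def algebra_simps)
  have "cos z \<le> cos (3 * \<theta> / 2)"
  proof (cases "z \<le> pi")
    case True then show ?thesis using z1 \<theta> by (intro cos_monotone_0_pi_le) auto
  next
    case False
    have "cos (2 * pi - z) \<le> cos (3 * \<theta> / 2)" using z2 \<theta> False by (intro cos_monotone_0_pi_le) auto
    then show ?thesis by (simp add: cos_diff)
  qed
  moreover have "sin (\<theta> / 2) \<ge> 0"
  proof (rule sin_ge_zero)
    have "\<theta> * 1 \<le> \<theta> * real n" using \<theta> assms(1) by (intro mult_left_mono) auto
    then show "\<theta> / 2 \<le> pi" using n\<theta> by (simp add: mult.commute)
  qed (use \<theta> in simp)
  ultimately have "sin (real d * \<theta> + \<theta>) - sin (real d * \<theta>) \<le> 2 * sin (\<theta> / 2) * cos (3 * \<theta> / 2)"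
    unfolding diff z_def by (intro mult_left_mono) auto
  also have "\<dots> = sin (2 * \<theta>) - sin \<theta>" using diff[of \<theta>] by simp
  finally show ?case using step.IH step.prems unfolding \<theta>_def[symmetric] by (simp add: algebra_simps)
qed

text \<open>The integers \<open>-1\<close> and \<open>0\<close> are included because two vertices of an inscribed polygon may lie on the same edge of
  the regular polygon, and then the index difference of edge endpoints can be \<open>-1\<close>.\<close>

lemma sin_chord:
  assumes n: "n \<ge> 3" and d: "-1 \<le> d" "d \<le> int n - 1"
  shows "sin (real_of_int d * (2 * pi / n)) \<le> sin (2 * pi / n) + (real_of_int d - 1) * (sin (2 * (2 * pi / n)) - sin (2 * pi / n))"
proof -
  define \<theta> where "\<theta> = 2 * pi / n"
  have "2 * pi / real n \<le> pi" using n by (simp add: divide_simps)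
  then have s: "sin \<theta> \<ge> 0" unfolding \<theta>_def by (intro sin_ge_zero) auto
  then have "sin \<theta> * (1 - cos \<theta>) \<ge> 0" by (intro mult_nonneg_nonneg) auto
  then have c: "2 * sin \<theta> - sin (2 * \<theta>) \<ge> 0" unfolding sin_double by (simp add: algebra_simps)
  consider "d = -1" | "d = 0" | "1 \<le> d" using d by linarith
  then show ?thesis
  proof cases
    case 1 then show ?thesis using c by (simp add: \<theta>_def)
  next
    case 2 then show ?thesis using c by (simp add: \<theta>_def)
  next
    case 3
    then obtain k where "d = int k" using zero_le_imp_eq_int[of d] by auto
    then show ?thesis using sin_chord_nat[OF n, of k] 3 d by simp
  qed
qed

text \<open>The point is first pushed radially to the edge of its sector (factor \<open>s\<close>) and then located on that edge by \<open>b\<close>;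
  \<open>s \<le> 1\<close> because the edge bounds the polygon.\<close>

lemma sector_coordinates:
  assumes n: "n \<ge> 3" and q: "q \<in> convex hull (range (regular n))" "q = \<rho> *\<^sub>R dir \<phi>" "\<rho> > 0" and \<phi>: "\<phi> \<ge> 0"
  obtains k b s where "real k * (2 * pi / n) \<le> \<phi>" "\<phi> < (real k + 1) * (2 * pi / n)" "0 \<le> b" "b \<le> 1" "0 < s" "s \<le> 1"
    "q = s *\<^sub>R ((1 - b) *\<^sub>R regular n k + b *\<^sub>R regular n (Suc k))"
proof -
  define \<theta> where "\<theta> = 2 * pi / n"
  have \<theta>: "0 < \<theta>" "\<theta> < pi" using n by (simp_all add: \<theta>_def divide_simps)
  then have s\<theta>: "sin \<theta> > 0" by (rule sin_gt_zero)
  define k where "k = nat \<lfloor>\<phi> / \<theta>\<rfloor>"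
  have rk: "real k = of_int \<lfloor>\<phi> / \<theta>\<rfloor>" using \<phi> \<theta> by (simp add: k_def)
  then have "real k \<le> \<phi> / \<theta>" "\<phi> / \<theta> < real k + 1" by linarith+
  then have k: "real k * \<theta> \<le> \<phi>" "\<phi> < (real k + 1) * \<theta>" using \<theta> by (simp_all add: field_simps)
  define x where "x = \<phi> - real k * \<theta>"
  have x: "0 \<le> x" "x < \<theta>" using k by (simp_all add: x_def algebra_simps)
  define A where "A = \<rho> * sin (\<theta> - x) / sin \<theta>"
  define B where "B = \<rho> * sin x / sin \<theta>"
  have "sin (\<theta> - x) > 0" using x \<theta> by (intro sin_gt_zero) auto
  then have A: "A > 0" using s\<theta> q(3) by (simp add: A_def)
  have "sin x \<ge> 0" using x \<theta> by (intro sin_ge_zero) auto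
  then have B: "B \<ge> 0" using s\<theta> q(3) by (simp add: B_def)
  have r: "regular n k = dir (real k * \<theta>)" "regular n (Suc k) = dir (real k * \<theta> + \<theta>)"
    by (simp_all add: regular_def \<theta>_def algebra_simps add_divide_distrib)
  have "sin (\<theta> - x) *\<^sub>R dir y + sin x *\<^sub>R dir (y + \<theta>) = sin \<theta> *\<^sub>R dir (y + x)" for y
  proof -
    have "cos x * cos x = 1 - sin x * sin x" "cos \<theta> * cos \<theta> = 1 - sin \<theta> * sin \<theta>"
      using sin_cos_squared_add[of x] sin_cos_squared_add[of \<theta>] by (simp_all add: power2_eq_square algebra_simps)
    then show ?thesis by (simp add: real2_eq_iff sin_add cos_add sin_diff algebra_simps)
  qed
  from this[of "real k * \<theta>"] have "(\<rho> / sin \<theta>) *\<^sub>R (sin (\<theta> - x) *\<^sub>R dir (real k * \<theta>) + sin x *\<^sub>R dir (real k * \<theta> + \<theta>)) = \<rho> *\<^sub>R dir \<phi>"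
    using s\<theta> by (simp add: x_def)
  then have qAB: "q = A *\<^sub>R regular n k + B *\<^sub>R regular n (Suc k)"
    unfolding q(2) r by (simp add: A_def B_def scaleR_add_right)
  have "0 \<le> orient (regular n k) (regular n (Suc k)) q"
    by (rule orient_hull_ge[OF q(1)]) (use cycle_edge_nonneg[OF regular_cycle[OF n]] n in auto)
  also have "\<dots> = sin \<theta> * (1 - (A + B))"
    unfolding orient_conv_cross2 qAB cross2_add by (simp add: r algebra_simps)
  finally have AB: "A + B \<le> 1" using s\<theta> by (simp add: zero_le_mult_iff)
  have "A + B > 0" using A B by simp
  then have b: "1 - B / (A + B) = A / (A + B)" by (simp add: field_simps)
  have "q = (A + B) *\<^sub>R ((1 - B / (A + B)) *\<^sub>R regular n k + (B / (A + B)) *\<^sub>R regular n (Suc k))"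
    unfolding b using \<open>A + B > 0\<close> qAB by (simp add: scaleR_add_right)
  then show ?thesis using that[of k "B / (A + B)" "A + B"] k A B AB by (simp add: \<theta>_def)
qed

section \<open>Polygons inscribed in a regular polygon\<close>

text \<open>Seen from \<open>q 0\<close> the vertices are sorted by angle, so they pass the direction of the origin only once.\<close>

lemma cycle_turns_once:
  assumes q: "convex_cycle m q" and pos: "\<And>i. i < m \<Longrightarrow> cross2 (q i) (q (Suc i)) > 0"
    and i: "0 < i" "Suc i < m" "cross2 (q 0) (q i) \<le> 0"
  shows "cross2 (q 0) (q (Suc i)) < 0"
proof -
  have s1: "cross2 (q 0) (q 1) > 0" using pos[of 0] i by simp
  then have "i \<noteq> 1" using i by auto
  then have o: "orient (q 0) (q 1) (q i) > 0" "orient (q 0) (q 1) (q (Suc i)) > 0" "orient (q 0) (q i) (q (Suc i)) > 0"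
    using i by (auto intro!: cycle_pos[OF q])
  have "orient (q 0) (q 1) (q i) * cross2 (q 0) (q (Suc i)) =
        orient (q 0) (q 1) (q (Suc i)) * cross2 (q 0) (q i) - cross2 (q 0) (q 1) * orient (q 0) (q i) (q (Suc i))"
    by (simp add: orient_def cross2_def algebra_simps)
  also have "\<dots> < 0"
    using mult_nonneg_nonpos[of "orient (q 0) (q 1) (q (Suc i))" "cross2 (q 0) (q i)"] o i s1
      mult_pos_pos[OF s1 o(3)] by linarith
  finally show ?thesis using o(1) by (simp add: mult_less_0_iff)
qed

text \<open>With boundary parameter \<open>x = k + b\<close>, the cross product of two boundary points is bilinear in the positions on their
  edges. Bounding its four sines by the chord of \<open>sin_chord\<close> leaves an affine function of
  \<open>x (Suc i) - x i\<close>; the sum over \<open>i\<close> telescopes to the total parameter \<open>n\<close>.\<close>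

lemma inscribed_around_center:
  assumes n: "n \<ge> 6" and q: "convex_cycle (n - 1) q" "range q \<subseteq> convex hull (range (regular n))"
    and pos: "\<And>i. i < n - 1 \<Longrightarrow> cross2 (q i) (q (Suc i)) > 0"
  shows "cycle_area2 (n - 1) q \<le> (real n - 2) * sin (2 * pi / n) + sin (2 * (2 * pi / n))"
proof -
  define m where "m = n - 1"
  have m: "0 < m" using n by (simp add: m_def)
  define \<theta> where "\<theta> = 2 * pi / n"
  have \<theta>: "0 < \<theta>" and n\<theta>: "real n * \<theta> = 2 * pi" using n by (simp_all add: \<theta>_def)
  have closed: "q m = q 0" using cycle_period[OF q(1), of 0] by (simp add: m_def)
  obtain \<phi> where \<phi>: "0 \<le> \<phi> 0" "\<phi> m = \<phi> 0 + 2 * pi"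
    "\<And>i. i \<le> m \<Longrightarrow> q i = norm (q i) *\<^sub>R dir (\<phi> i)"
    "\<And>i. i < m \<Longrightarrow> \<phi> i < \<phi> (Suc i) \<and> \<phi> (Suc i) < \<phi> i + pi"
    using turning_angles[of m q, OF m closed] pos cycle_turns_once[OF q(1) pos]
    unfolding m_def by blast
  have \<phi>nn: "0 \<le> \<phi> i" if "i \<le> m" for i
    using that
  proof (induction i)
    case (Suc i) then show ?case using \<phi>(4)[of i] by simp
  qed (use \<phi> in simp)
  have nz: "norm (q i) > 0" if "i < m" for i using pos[of i] that by (auto simp: m_def)
  have "\<forall>i. \<exists>k b s. i < m \<longrightarrow> real k * \<theta> \<le> \<phi> i \<and> \<phi> i < (real k + 1) * \<theta> \<and> 0 \<le> b \<and> b \<le> 1 \<and> 0 < s \<and> s \<le> 1 \<and>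
    q i = s *\<^sub>R ((1 - b) *\<^sub>R regular n k + b *\<^sub>R regular n (Suc k))"
  proof
    fix i
    show "\<exists>k b s. i < m \<longrightarrow> real k * \<theta> \<le> \<phi> i \<and> \<phi> i < (real k + 1) * \<theta> \<and> 0 \<le> b \<and> b \<le> 1 \<and> 0 < s \<and> s \<le> 1 \<and>
      q i = s *\<^sub>R ((1 - b) *\<^sub>R regular n k + b *\<^sub>R regular n (Suc k))"
    proof (cases "i < m")
      case True
      have n3: "n \<ge> 3" using n by simp
      have qi: "q i \<in> convex hull (range (regular n))" using q(2) by blast
      have rho: "q i = norm (q i) *\<^sub>R dir (\<phi> i)" using \<phi>(3)[of i] True by simp
      have pn: "0 \<le> \<phi> i" using \<phi>nn[of i] True by simp
      show ?thesis
        by (rule sector_coordinates[OF n3 qi rho nz[OF True] pn]) (unfold \<theta>_def, blast)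
    qed simp
  qed
  then obtain k0 b0 s0 where rep0: "\<And>i. i < m \<Longrightarrow> real (k0 i) * \<theta> \<le> \<phi> i \<and> \<phi> i < (real (k0 i) + 1) * \<theta> \<and>
      0 \<le> b0 i \<and> b0 i \<le> 1 \<and> 0 < s0 i \<and> s0 i \<le> (1::real) \<and>
      q i = s0 i *\<^sub>R ((1 - b0 i) *\<^sub>R regular n (k0 i) + b0 i *\<^sub>R regular n (Suc (k0 i)))"
    by metis
  \<comment> \<open>The closing vertex \<open>q m = q 0\<close> is counted one full turn later, so that \<open>k\<close> increases along the cycle.\<close>
  define k where "k i = (if i = m then k0 0 + n else k0 i)" for i
  define b where "b i = (if i = m then b0 0 else b0 i)" for i
  define s where "s i = (if i = m then s0 0 else s0 i)" for i
  have rep: "real (k i) * \<theta> \<le> \<phi> i" "\<phi> i < (real (k i) + 1) * \<theta>" "0 \<le> b i" "b i \<le> 1" "0 < s i" "s i \<le> 1"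
     "q i = s i *\<^sub>R ((1 - b i) *\<^sub>R regular n (k i) + b i *\<^sub>R regular n (Suc (k i)))" if "i \<le> m" for i
  proof -
    have per: "regular n (j + n) = regular n j" for j
      using cycle_period[OF regular_cycle] n by simp
    have "regular n (Suc (k0 0 + n)) = regular n (Suc (k0 0))" using per[of "Suc (k0 0)"] by simp
    then have wrap: "real (k m) * \<theta> = real (k0 0) * \<theta> + 2 * pi" "(real (k m) + 1) * \<theta> = (real (k0 0) + 1) * \<theta> + 2 * pi"
      "regular n (k m) = regular n (k0 0)" "regular n (Suc (k m)) = regular n (Suc (k0 0))"
      using n\<theta> per by (simp_all add: k_def distrib_right)
    have "real (k i) * \<theta> \<le> \<phi> i \<and> \<phi> i < (real (k i) + 1) * \<theta> \<and> 0 \<le> b i \<and> b i \<le> 1 \<and> 0 < s i \<and> s i \<le> 1 \<and>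
      q i = s i *\<^sub>R ((1 - b i) *\<^sub>R regular n (k i) + b i *\<^sub>R regular n (Suc (k i)))"
    proof (cases "i = m")
      case True
      then show ?thesis unfolding True wrap closed \<phi>(2) using rep0[OF m] by (simp add: b_def s_def)
    next
      case False
      then show ?thesis using rep0[of i] that by (simp add: k_def b_def s_def)
    qed
    then show "real (k i) * \<theta> \<le> \<phi> i" "\<phi> i < (real (k i) + 1) * \<theta>" "0 \<le> b i" "b i \<le> 1" "0 < s i" "s i \<le> 1"
     "q i = s i *\<^sub>R ((1 - b i) *\<^sub>R regular n (k i) + b i *\<^sub>R regular n (Suc (k i)))"
      by blast+
  qed
  define \<sigma> where "\<sigma> = sin (2 * \<theta>) - sin \<theta>"
  define L where "L d = sin \<theta> + (d - 1) * \<sigma>" for d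
  define x where "x i = real (k i) + b i" for i
  have step: "cross2 (q i) (q (Suc i)) \<le> L (x (Suc i) - x i)" if i: "i < m" for i
  proof -
    let ?p = "\<lambda>i. (1 - b i) *\<^sub>R regular n (k i) + b i *\<^sub>R regular n (Suc (k i))"
    define d where "d = int (k (Suc i)) - int (k i)"
    have Si: "Suc i \<le> m" "i \<le> m" using i by auto
    have "real (k i) * \<theta> < (real (k (Suc i)) + 1) * \<theta>" using rep(1)[OF Si(2)] rep(2)[OF Si(1)] \<phi>(4)[OF i] by linarith
    then have d0: "0 \<le> d" using \<theta> by (simp add: d_def)
    have "real (k (Suc i)) * \<theta> < (real (k i) + 1) * \<theta> + real n * \<theta> / 2"
      using rep(1)[OF Si(1)] rep(2)[OF Si(2)] \<phi>(4)[OF i] n\<theta> by linarith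
    then have "real (k (Suc i)) * \<theta> < (real (k i) + 1 + real n / 2) * \<theta>" by (simp add: algebra_simps)
    then have "real (k (Suc i)) < real (k i) + 1 + real n / 2" using \<theta> by simp
    then have d1: "d + 1 \<le> int n - 1" using n unfolding d_def by linarith
    have ch: "sin (of_int e * \<theta>) \<le> L (of_int e)" if "-1 \<le> e" "e \<le> int n - 1" for e
      using sin_chord[of n e] that n by (simp add: L_def \<sigma>_def \<theta>_def)
    have cr: "cross2 (regular n j) (regular n l) = sin (of_int (int l - int j) * \<theta>)" for j l
      by (simp add: cross2_regular \<theta>_def)
    let ?b = "b i" and ?c = "b (Suc i)"
    have b: "0 \<le> ?b" "?b \<le> 1" "0 \<le> ?c" "?c \<le> 1" using rep(3,4)[OF Si(1)] rep(3,4)[OF Si(2)] by auto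
    have "cross2 (?p i) (?p (Suc i)) =
        (1 - ?b) * (1 - ?c) * sin (of_int d * \<theta>) + (1 - ?b) * ?c * sin (of_int (d + 1) * \<theta>)
        + ?b * (1 - ?c) * sin (of_int (d - 1) * \<theta>) + ?b * ?c * sin (of_int d * \<theta>)"
      by (simp add: cross2_add cr d_def algebra_simps)
    also have "\<dots> \<le> (1 - ?b) * (1 - ?c) * L (of_int d) + (1 - ?b) * ?c * L (of_int (d + 1))
        + ?b * (1 - ?c) * L (of_int (d - 1)) + ?b * ?c * L (of_int d)"
      using d0 d1 b by (intro add_mono mult_left_mono ch mult_nonneg_nonneg) auto
    also have "\<dots> = L (x (Suc i) - x i)" by (simp add: L_def x_def d_def algebra_simps)
    finally have pp: "cross2 (?p i) (?p (Suc i)) \<le> L (x (Suc i) - x i)" .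
    have "cross2 (q i) (q (Suc i)) = (s i * s (Suc i)) * cross2 (?p i) (?p (Suc i))"
      by (subst rep(7)[OF Si(1)], subst rep(7)[OF Si(2)]) simp
    moreover have "0 < cross2 (q i) (q (Suc i))" using pos[of i] i by (simp add: m_def)
    moreover have "0 < s i * s (Suc i)" "s i * s (Suc i) \<le> 1"
      using rep(5,6)[OF Si(1)] rep(5,6)[OF Si(2)] by (auto intro: mult_le_one)
    \<comment> \<open>Pushing outwards does not decrease the area, because the triangle is positively oriented.\<close>
    ultimately have "cross2 (q i) (q (Suc i)) \<le> cross2 (?p i) (?p (Suc i))"
      by (metis less_imp_le mult_left_le_one_le mult.commute zero_less_mult_pos)
    then show ?thesis using pp by linarith
  qed
  have "cycle_area2 m q \<le> (\<Sum>i<m. L (x (Suc i) - x i))"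
    unfolding cycle_area2_def by (intro sum_mono step) auto
  also have "\<dots> = (\<Sum>i<m. (sin \<theta> - \<sigma>) + \<sigma> * (x (Suc i) - x i))" by (simp add: L_def algebra_simps)
  also have "\<dots> = real m * (sin \<theta> - \<sigma>) + \<sigma> * (x m - x 0)"
    by (simp add: sum.distrib sum_lessThan_telescope flip: sum_distrib_left)
  also have "x m - x 0 = real n" using m by (simp add: x_def k_def b_def)
  also have "real m * (sin \<theta> - \<sigma>) + \<sigma> * real n = (real n - 2) * sin \<theta> + sin (2 * \<theta>)"
    using n by (simp add: m_def \<sigma>_def of_nat_diff algebra_simps)
  finally show ?thesis by (simp add: m_def \<theta>_def)
qed

text \<open>Some two consecutive vertices of the regular polygon have directions within the half-turn clockwise of \<open>e\<close>; their
  triangle with the centre lies on the other side of the line spanned by \<open>e\<close>.\<close>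

lemma inscribed_beside_center:
  assumes n: "n \<ge> 4" and e: "e \<noteq> 0" and Q: "Q \<subseteq> convex hull (range (regular n))" "Q \<in> lmeasurable"
    and side: "\<And>x. x \<in> Q \<Longrightarrow> cross2 e x \<ge> 0"
  shows "area Q \<le> area (convex hull (range (regular n))) - sin (2 * pi / n) / 2"
proof -
  define \<theta> where "\<theta> = 2 * pi / n"
  have \<theta>: "0 < \<theta>" "\<theta> \<le> pi / 2" using n by (simp_all add: \<theta>_def divide_simps)
  have s\<theta>: "sin \<theta> > 0" using \<theta> pi_gt_zero by (intro sin_gt_zero) linarith+
  let ?P = "convex hull (range (regular n))"
  obtain t where t: "0 \<le> t" "t < 2 * pi" "e = norm e *\<^sub>R dir t" by (rule polar_form)
  \<comment> \<open>Adding \<open>2\<pi>\<close> keeps the natural number \<open>k\<close> clear of truncation at zero.\<close>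
  define k where "k = nat \<lfloor>(t + 2 * pi) / \<theta>\<rfloor> - 1"
  have "\<theta> \<le> t + 2 * pi" using t(1) \<theta> pi_gt_zero by linarith
  then have "1 \<le> (t + 2 * pi) / \<theta>" using \<theta> by simp
  then have "1 \<le> \<lfloor>(t + 2 * pi) / \<theta>\<rfloor>" by linarith
  then have "real k + 1 = of_int \<lfloor>(t + 2 * pi) / \<theta>\<rfloor>" by (simp add: k_def of_nat_diff nat_le_iff le_nat_iff)
  then have "real k + 1 \<le> (t + 2 * pi) / \<theta>" "(t + 2 * pi) / \<theta> < real k + 2" by linarith+
  then have k: "(real k + 1) * \<theta> \<le> t + 2 * pi" "t + 2 * pi < (real k + 2) * \<theta>" using \<theta> by (simp_all add: field_simps)
  have neg: "cross2 e (regular n j) \<le> 0" if "real j * \<theta> \<le> t + 2 * pi" "t + 2 * pi - pi \<le> real j * \<theta>" for j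
  proof -
    have "cross2 e (regular n j) = norm e * sin (real j * \<theta> - t)"
      by (subst t(3)) (simp add: regular_def \<theta>_def)
    also have "sin (real j * \<theta> - t) = - sin (t + 2 * pi - real j * \<theta>)"
      by (simp add: sin_diff sin_add cos_add algebra_simps)
    finally show ?thesis using that sin_ge_zero[of "t + 2 * pi - real j * \<theta>"] by (simp add: mult_nonneg_nonneg)
  qed
  have n1: "cross2 e (regular n k) \<le> 0" using k \<theta> by (intro neg) (auto simp: algebra_simps)
  have n2: "cross2 e (regular n (Suc k)) \<le> 0" using k \<theta> by (intro neg) (auto simp: algebra_simps)
  let ?T = "convex hull {0, regular n k, regular n (Suc k)}"
  have T: "?T \<subseteq> {x. cross2 e x \<le> 0}"
  proof (rule hull_minimal)
    show "convex {x. cross2 e x \<le> 0}" using orient_halfplane(2)[of 0 e 0] by (simp add: orient_def)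
  qed (use n1 n2 in auto)
  have TP: "?T \<subseteq> ?P" using zero_in_regular[of n] n by (intro hull_minimal) (auto intro: hull_inc)
  have aT: "area ?T = sin \<theta> / 2"
    using s\<theta> unfolding area_triangle orient_conv_cross2 by (simp add: cross2_regular \<theta>_def)
  have "negligible (Q \<inter> ?T)"
    using negligible_subset[OF negligible_cross2_line[OF e, of 0], of "Q \<inter> ?T"] side T by force
  then have "area (Q \<union> ?T) = area Q + sin \<theta> / 2"
    using area_Un_negligible[OF Q(2), of ?T] aT by (simp add: hull_lmeasurable)
  moreover have "area (Q \<union> ?T) \<le> area ?P"
  proof (rule measure_mono_fmeasurable)
    show "Q \<union> ?T \<in> sets lebesgue" using Q(2) hull_lmeasurable[of "{0, regular n k, regular n (Suc k)}"] 
      by (simp add: fmeasurableD sets.Un)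
    show "?P \<in> lmeasurable" using cycle_lmeasurable[OF regular_cycle] n by simp
  qed (use Q TP in auto)
  ultimately show ?thesis by (simp add: \<theta>_def)
qed

text \<open>If the centre is not strictly to the left of some edge of \<open>Q\<close>, then \<open>Q\<close> lies to the left of the parallel line through
  the centre and misses a central triangle, a loss of \<open>1/n \<ge> 4/n \<cdot> sin\<^sup>2(\<pi>/n)\<close>.\<close>

lemma regular_inscribed_area:
  assumes n: "n \<ge> 6" and Q: "convex_ngon (n - 1) Q" "Q \<subseteq> convex hull (range (regular n))"
  shows "area Q \<le> (1 - 4 / n * (sin (pi / n))\<^sup>2) * area (convex hull (range (regular n)))"
proof -
  let ?P = "convex hull (range (regular n))"
  define \<theta> where "\<theta> = 2 * pi / n"
  have rc: "convex_cycle n (regular n)" using n by (intro regular_cycle) simp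
  have aP: "area ?P = real n * sin \<theta> / 2" using area_cycle[OF rc] n by (simp add: regular_area2 \<theta>_def)
  have \<theta>: "0 < \<theta>" "\<theta> \<le> pi / 2" using n by (simp_all add: \<theta>_def divide_simps)
  have s\<theta>: "sin \<theta> > 0" using \<theta> pi_gt_zero by (intro sin_gt_zero) linarith+
  obtain q where q: "convex_cycle (n - 1) q" "Q = convex hull (range q)"
    by (rule cycle_of_convex_ngon[OF Q(1)]) (use n in linarith)+
  have aQ: "area Q = cycle_area2 (n - 1) q / 2" using area_cycle[OF q(1)] q(2) n by simp
  have half: "\<theta> = 2 * (pi / n)" by (simp add: \<theta>_def)
  show ?thesis
  proof (cases "\<forall>i<n-1. cross2 (q i) (q (Suc i)) > 0")
    case True
    have "range q \<subseteq> ?P" using Q(2) q(2) hull_subset[of "range q" convex] by blast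
    then have "area Q \<le> ((real n - 2) * sin \<theta> + sin (2 * \<theta>)) / 2"
      using inscribed_around_center[OF n q(1)] True aQ by (simp add: \<theta>_def)
    also have "\<dots> = (real n - 2 * (1 - cos \<theta>)) * sin \<theta> / 2" unfolding sin_double by (simp add: algebra_simps)
    also have "1 - cos \<theta> = 2 * (sin (pi / n))\<^sup>2" unfolding half cos_double_sin by simp
    also have "(real n - 2 * (2 * (sin (pi / n))\<^sup>2)) * sin \<theta> / 2 = (1 - 4 / n * (sin (pi / n))\<^sup>2) * area ?P"
      unfolding aP using n by (simp add: field_simps)
    finally show ?thesis .
  next
    case False
    then obtain i where i: "cross2 (q i) (q (Suc i)) \<le> 0" by (meson not_le)
    have "orient (q i) (q (Suc i)) (q (i + 2)) > 0" using n by (intro cycle_pos[OF q(1)]) linarith+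
    then have ne: "q (Suc i) - q i \<noteq> 0" by auto
    have "cross2 (q (Suc i) - q i) x \<ge> 0" if "x \<in> Q" for x
    proof -
      have "orient (q i) (q (Suc i)) x \<ge> 0"
      proof (rule orient_hull_ge)
        show "x \<in> convex hull (range q)" using that q(2) by simp
        have "n - 1 \<ge> 2" using n by simp
        then show "0 \<le> orient (q i) (q (Suc i)) y" if "y \<in> range q" for y
          using that cycle_edge_nonneg[OF q(1)] by blast
      qed
      moreover have "orient (q i) (q (Suc i)) x = cross2 (q (Suc i) - q i) x + cross2 (q i) (q (Suc i))"
        by (simp add: orient_def cross2_def algebra_simps)
      ultimately show ?thesis using i by simp
    qed
    moreover have "Q \<in> lmeasurable"
      unfolding q(2) using cycle_lmeasurable[OF q(1)] n by simp
    ultimately have "area Q \<le> area ?P - sin \<theta> / 2"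
      using inscribed_beside_center[OF _ ne Q(2)] n by (simp add: \<theta>_def)
    also have "\<dots> = (1 - 1 / n) * area ?P" unfolding aP using n by (simp add: field_simps)
    also have "\<dots> \<le> (1 - 4 / n * (sin (pi / n))\<^sup>2) * area ?P"
    proof (rule mult_right_mono)
      have "sin (pi / n) \<le> sin (pi / 6)" using n by (intro sin_monotone_2pi_le) (auto simp: divide_simps intro: order_trans[of _ 0])
      then have "sin (pi / n) \<le> 1 / 2" by (simp add: sin_30)
      moreover have "0 \<le> sin (pi / n)" using n by (intro sin_ge_zero) (auto simp: divide_simps)
      ultimately have "(sin (pi / n))\<^sup>2 \<le> (1 / 2)\<^sup>2" by (intro power_mono)
      then have "4 * (sin (pi / n))\<^sup>2 / n \<le> 1 / n" using n by (intro divide_right_mono) (auto simp: power2_eq_square)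
      then show "1 - 1 / real n \<le> 1 - 4 / n * (sin (pi / n))\<^sup>2" by simp
    qed (use aP s\<theta> in auto)
    finally show ?thesis .
  qed
qed

section \<open>The least ear is at most the mean share of the area\<close>

text \<open>The vertex \<open>x\<close> lies beyond the line through the two outer neighbours \<open>a\<close>, \<open>d\<close> of the edge and inside the
  extensions of the adjacent edges. This is a wedge at the lower of \<open>a\<close> and \<open>d\<close> whose two rays both
  rise from the edge; the two identities express \<open>x\<close> in the coordinates of that wedge.\<close>

lemma vertex_above_edge:
  assumes v: "convex_cycle n v" and n: "n \<ge> 3"
    and ears: "\<And>i. t \<le> orient (v i) (v (Suc i)) (v (i + 2))"
    and k: "i + 2 \<le> k" "k < i + n"
  shows "t \<le> orient (v i) (v (Suc i)) (v k)"
proof -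
  let ?b = "v i" and ?c = "v (Suc i)" and ?d = "v (i + 2)" and ?a = "v (i + n - 1)" and ?x = "v k"
  have "Suc (i + n - 1) = i + n" "i + n - 1 + 2 = Suc i + n" using n by simp_all
  then have "t \<le> orient ?a ?b ?c" 
    using ears[of "i + n - 1"] cycle_period[OF v, of i] cycle_period[OF v, of "Suc i"] by metis
  then have bca: "t \<le> orient ?b ?c ?a" by (simp add: orient_rotate)
  have bcd: "t \<le> orient ?b ?c ?d" by (rule ears)
  consider "k = i + 2" | "k = i + n - 1" | "i + 2 < k" "k < i + n - 1" using k by linarith
  then show ?thesis
  proof cases
    case 3
    have pos: "orient ?c ?d ?a > 0" "orient ?d ?x ?a > 0" "orient ?c ?d ?x > 0" "orient ?b ?d ?a > 0" "orient ?b ?x ?a > 0"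
        "orient ?b ?c ?a > 0" "orient ?b ?c ?d > 0" "orient ?b ?c ?x > 0"
      using 3 by (auto intro!: cycle_pos[OF v])
    show ?thesis
    proof (cases "orient ?b ?c ?d \<le> orient ?b ?c ?a")
      case True
      have "orient ?c ?d ?a * (orient ?b ?c ?x - orient ?b ?c ?d) =
        orient ?d ?x ?a * orient ?b ?c ?d + orient ?c ?d ?x * (orient ?b ?c ?a - orient ?b ?c ?d)"
        by (simp add: orient_def cross2_def algebra_simps)
      also have "\<dots> \<ge> 0" using True pos by (simp add: less_imp_le)
      finally show ?thesis using pos bcd by (simp add: zero_le_mult_iff)
    next
      case False
      have "orient ?b ?d ?a * (orient ?b ?c ?x - orient ?b ?c ?a) =
        orient ?d ?x ?a * orient ?b ?c ?a + orient ?b ?x ?a * (orient ?b ?c ?d - orient ?b ?c ?a)"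
        by (simp add: orient_def cross2_def algebra_simps)
      also have "\<dots> \<ge> 0" using False pos by (simp add: less_imp_le)
      finally show ?thesis using pos bca by (simp add: zero_le_mult_iff)
    qed
  qed (use bca bcd in auto)
qed

lemma cycle_area2_from_point:
  assumes v: "convex_cycle n v"
  shows "cycle_area2 n v = (\<Sum>i<n. orient (v i) (v (Suc i)) p)"
proof -
  have "(\<Sum>i<n. orient (v i) (v (Suc i)) p) =
      cycle_area2 n v + (\<Sum>i<n. cross2 (v (Suc i)) p - cross2 (v i) p)"
    by (simp add: cycle_area2_def orient_conv_cross2 cross2_skew[of _ p] sum.distrib[symmetric] algebra_simps)
  also have "(\<Sum>i<n. cross2 (v (Suc i)) p - cross2 (v i) p) = cross2 (v n) p - cross2 (v 0) p"
    by (rule sum_lessThan_telescope)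
  finally show ?thesis using cycle_period[OF v, of 0] by simp
qed

text \<open>Any three of the hulls share a vertex, since three edges have at most six end points; Helly's theorem applies in the
  plane. It is stated for sets of sets, so a family with at most three members is treated
  directly.\<close>

lemma deep_point:
  assumes v: "convex_cycle n v" and n: "n \<ge> 7"
  obtains p where "\<And>i. i < n \<Longrightarrow> p \<in> convex hull (v ` {i+2..<i+n})"
proof -
  define C where "C i = convex hull (v ` {i+2..<i+n})" for i
  have common: "\<exists>x. \<forall>i\<in>I. x \<in> C i" if I: "I \<subseteq> {..<n}" "card I \<le> 3" for I
  proof -
    define B where "B = (\<lambda>i. i mod n) ` I \<union> (\<lambda>i. Suc i mod n) ` I"
    have fI: "finite I" using I(1) finite_subset by blast
    have "card B \<le> card I + card I" unfolding B_def
      by (rule order_trans[OF card_Un_le]) (intro add_mono card_image_le fI)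
    then have "card B < card {..<n}" using I(2) n by simp
    moreover have "finite B" using fI by (simp add: B_def)
    ultimately obtain j where j: "j < n" "j \<notin> B" by (metis card_mono lessThan_iff not_le subsetI)
    have "v j \<in> C i" if "i \<in> I" for i
    proof -
      obtain k where k: "i \<le> k" "k < i + n" "k mod n = j mod n" using mod_index_from[of n i j] n by auto
      have "k mod n = j" using k j by simp
      then have "k \<noteq> i" "k \<noteq> Suc i" using j(2) that by (auto simp: B_def)
      then have "k \<in> {i+2..<i+n}" using k by auto
      moreover have "v k = v j" using cycle_mod[OF v] k(3) by metis
      ultimately show ?thesis unfolding C_def by (metis hull_inc imageI)
    qed
    then show ?thesis by blast
  qed
  have sub: "\<Inter>T \<noteq> {}" if T: "T \<subseteq> C ` {..<n}" "card T \<le> 3" for T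
  proof -
    obtain I where I: "I \<subseteq> {..<n}" "inj_on C I" "T = C ` I" using T(1) unfolding subset_image_inj by blast
    then have "card I \<le> 3" using T(2) by (simp add: card_image)
    then show ?thesis using common[OF I(1)] I(3) by auto
  qed
  have "\<Inter>(C ` {..<n}) \<noteq> {}"
  proof (cases "card (C ` {..<n}) \<le> 3")
    case True then show ?thesis by (intro sub) auto
  next
    case False
    show ?thesis
    proof (rule Helly)
      show "DIM(real^2) + 1 \<le> card (C ` {..<n})" using False by simp
      show "\<forall>s\<in>C ` {..<n}. convex s" by (auto simp: C_def)
      show "\<And>T. T \<subseteq> C ` {..<n} \<Longrightarrow> card T = DIM(real^2) + 1 \<Longrightarrow> \<Inter>T \<noteq> {}" by (intro sub) auto
    qed
  qed
  then show ?thesis using that unfolding C_def by auto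
qed

lemma ears_le_of_deep_point:
  assumes v: "convex_cycle n v" and n: "n \<ge> 7"
    and ears: "\<And>i. t \<le> orient (v i) (v (Suc i)) (v (i + 2))"
  shows "real n * t \<le> cycle_area2 n v"
proof -
  obtain p where p: "\<And>i. i < n \<Longrightarrow> p \<in> convex hull (v ` {i+2..<i+n})" using deep_point[OF v n] by blast
  have "t \<le> orient (v i) (v (Suc i)) p" if "i < n" for i
    by (rule orient_hull_ge[OF p[OF that]]) (use vertex_above_edge[OF v _ ears] n in auto)
  then have "(\<Sum>i<n. t) \<le> (\<Sum>i<n. orient (v i) (v (Suc i)) p)" by (intro sum_mono) auto
  then show ?thesis unfolding cycle_area2_from_point[OF v, of p] by simp
qed

text \<open>Both segments contain the point whose barycentric weights are the areas cut off by the other diagonal.\<close>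

lemma diagonals_cross:
  assumes "orient a b c > 0" "orient a b d > 0" "orient a c d > 0" "orient b c d > 0"
  obtains p where "p \<in> closed_segment a c" "p \<in> closed_segment b d"
proof -
  define D where "D = orient a b d + orient b c d"
  have D: "D = orient a b c + orient a c d" by (simp add: D_def orient_def cross2_def algebra_simps)
  have Dpos: "D > 0" using assms by (simp add: D_def)
  have "orient b c d *\<^sub>R a + orient a b d *\<^sub>R c = orient a c d *\<^sub>R b + orient a b c *\<^sub>R d"
    by (simp add: real2_eq_iff orient_def cross2_def algebra_simps)
  then have "(1 / D) *\<^sub>R (orient b c d *\<^sub>R a + orient a b d *\<^sub>R c) = (1 / D) *\<^sub>R (orient a c d *\<^sub>R b + orient a b c *\<^sub>R d)"
    by simp
  then have eq: "(orient b c d / D) *\<^sub>R a + (orient a b d / D) *\<^sub>R c = (orient a c d / D) *\<^sub>R b + (orient a b c / D) *\<^sub>R d"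
    by (simp add: scaleR_add_right)
  have "1 - orient a b d / D = orient b c d / D" "1 - orient a b c / D = orient a c d / D"
    using Dpos by (simp_all add: field_simps) (simp_all add: D_def D[unfolded D_def])
  then have "(orient b c d / D) *\<^sub>R a + (orient a b d / D) *\<^sub>R c \<in> closed_segment a c"
    "(orient a c d / D) *\<^sub>R b + (orient a b c / D) *\<^sub>R d \<in> closed_segment b d"
    unfolding in_segment using assms Dpos D D_def by (metis divide_le_eq_1_pos divide_nonneg_pos less_add_same_cancel1 less_add_same_cancel2 less_imp_le)+
  then show ?thesis using that eq by metis
qed

lemma diagonals_of_cycle_cross:
  assumes "convex_cycle n v" "i < j" "j < k" "k < l" "l < i + n"
  obtains p where "p \<in> closed_segment (v i) (v k)" "p \<in> closed_segment (v j) (v l)"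
  by (rule diagonals_cross[of "v i" "v j" "v k" "v l"]) (use assms in \<open>auto intro!: cycle_pos[OF assms(1)]\<close>)

lemma orient_segment_ge:
  assumes "p \<in> closed_segment x y" "t \<le> orient a b x" "t \<le> orient a b y"
  shows "t \<le> orient a b p"
  using orient_hull_ge[of p "{x, y}" t a b] assms by (auto simp: segment_convex_hull)

text \<open>The triangle of three lines has twice the signed area \<open>x\<^sup>2 (g \<times> u) (g \<times> w) / (w \<times> u)\<close>, so its orientation depends
  only on the directions of the lines.\<close>

lemma diagonal_triangle_nonneg:
  assumes w: "cross2 w u > 0" and g: "cross2 g u \<le> 0" "cross2 g w \<le> 0"
    and PQR: "Q - P = s *\<^sub>R w" "R - P = r *\<^sub>R u" "R - Q = x *\<^sub>R g"
  shows "orient P Q R \<ge> 0"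
proof -
  have xg: "x *\<^sub>R g = r *\<^sub>R u - s *\<^sub>R w" using PQR by (metis diff_diff_eq2 diff_add_cancel add_diff_cancel_right')
  have "cross2 (x *\<^sub>R g) u = - (s * cross2 w u)" "cross2 (x *\<^sub>R g) w = - (r * cross2 w u)"
    unfolding xg by (simp_all add: cross2_add cross2_skew[of w u])
  then have e: "s * cross2 w u = - (x * cross2 g u)" "r * cross2 w u = - (x * cross2 g w)" by simp_all
  have "orient P Q R * cross2 w u = (s * cross2 w u) * (r * cross2 w u)"
    by (simp add: orient_def PQR)
  also have "\<dots> = x\<^sup>2 * (cross2 g u * cross2 g w)" unfolding e by (simp add: power2_eq_square)
  also have "\<dots> \<ge> 0" using g by (intro mult_nonneg_nonneg mult_nonpos_nonpos) auto
  finally show ?thesis using w by (simp add: zero_le_mult_iff)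
qed

lemma segment_diff:
  assumes "p \<in> closed_segment x y" "q \<in> closed_segment x y"
  obtains s where "q - p = s *\<^sub>R (y - x)"
proof -
  obtain a where p: "p = (1 - a) *\<^sub>R x + a *\<^sub>R y" using assms(1) by (auto simp: in_segment)
  obtain b where q: "q = (1 - b) *\<^sub>R x + b *\<^sub>R y" using assms(2) by (auto simp: in_segment)
  have "q - p = (b - a) *\<^sub>R (y - x)" unfolding p q by (simp add: algebra_simps)
  then show ?thesis using that by blast
qed

lemma orient_collinear:
  assumes "a \<in> closed_segment x y" "b \<in> closed_segment x y" "c \<in> closed_segment x y"
  shows "orient a b c = 0"
proof -
  obtain s where "b - a = s *\<^sub>R (y - x)" using segment_diff[OF assms(1,2)] .
  moreover obtain t where "c - a = t *\<^sub>R (y - x)" using segment_diff[OF assms(1,3)] .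
  ultimately show ?thesis by (simp add: orient_def)
qed

text \<open>Let the main diagonals meet in \<open>P = AD \<inter> CF\<close>, \<open>Q = BE \<inter> CF\<close>, \<open>R = AD \<inter> BE\<close>. The apex of each triangle
  \<open>ABP, BCP, CDQ, DEQ, EFR, FAR\<close> lies on the diagonal joining the outer neighbours of its base, so
  the triangle is at least as large as one of the two ears at that base. The six triangles and
  \<open>PQR\<close> add up to the hexagon, and \<open>PQR\<close> is never negatively oriented.\<close>

lemma ears_le_hexagon:
  assumes v: "convex_cycle 6 v"
    and ears: "\<And>i. t \<le> orient (v i) (v (Suc i)) (v (i + 2))"
  shows "6 * t \<le> cycle_area2 6 v"
proof -
  let ?A = "v 0" and ?B = "v 1" and ?C = "v 2" and ?D = "v 3" and ?E = "v 4" and ?F = "v 5"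
  have v67: "v 6 = ?A" "v 7 = ?B" using cycle_period[OF v, of 0] cycle_period[OF v, of 1] by simp_all
  have ear': "t \<le> orient (v i) (v j) (v k)" if "j = Suc i" "k = i + 2" for i j k
    using ears that by simp
  have ear: "t \<le> orient ?A ?B ?C" "t \<le> orient ?B ?C ?D" "t \<le> orient ?C ?D ?E"
     "t \<le> orient ?D ?E ?F" "t \<le> orient ?E ?F ?A" "t \<le> orient ?F ?A ?B"
    using ear'[of 1 0 2] ear'[of 2 1 3] ear'[of 3 2 4] ear'[of 4 3 5] ear'[of 5 4 6] ear'[of 6 5 7] v67
    by simp_all
  obtain P where P: "P \<in> closed_segment ?A ?D" "P \<in> closed_segment ?C ?F"
    by (rule diagonals_of_cycle_cross[OF v, of 0 2 3 5]) auto
  obtain Q where Q: "Q \<in> closed_segment ?B ?E" "Q \<in> closed_segment ?C ?F"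
    by (rule diagonals_of_cycle_cross[OF v, of 1 2 4 5]) auto
  obtain R where R: "R \<in> closed_segment ?A ?D" "R \<in> closed_segment ?B ?E"
    by (rule diagonals_of_cycle_cross[OF v, of 0 1 3 4]) auto
  have tri: "t \<le> orient ?A ?B P" "t \<le> orient ?B ?C P" "t \<le> orient ?C ?D Q"
    "t \<le> orient ?D ?E Q" "t \<le> orient ?E ?F R" "t \<le> orient ?F ?A R"
    using ear orient_segment_ge[OF P(2), of t ?A ?B] orient_segment_ge[OF P(1), of t ?B ?C]
      orient_segment_ge[OF Q(1), of t ?C ?D] orient_segment_ge[OF Q(2), of t ?D ?E]
      orient_segment_ge[OF R(1), of t ?E ?F] orient_segment_ge[OF R(2), of t ?F ?A]
    by (simp_all add: orient_rotate)
  have area: "cycle_area2 6 v = cross2 ?A ?B + cross2 ?B ?C + cross2 ?C ?D + cross2 ?D ?E + cross2 ?E ?F + cross2 ?F ?A"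
  proof -
    have "{..<6::nat} = {0, 1, 2, 3, 4, 5}" by auto
    then show ?thesis by (simp add: cycle_area2_def v67 numeral_2_eq_2[symmetric])
  qed
  have "orient ?A R P = 0" by (rule orient_collinear[of _ ?A ?D]) (use P R in auto)
  moreover have "orient ?C P Q = 0" by (rule orient_collinear[of _ ?C ?F]) (use P Q in auto)
  moreover have "orient ?E Q R = 0" by (rule orient_collinear[of _ ?B ?E]) (use Q R in auto)
  ultimately have split: "cycle_area2 6 v = orient ?A ?B P + orient ?B ?C P + orient ?C ?D Q + orient ?D ?E Q
      + orient ?E ?F R + orient ?F ?A R + orient P Q R"
    unfolding area orient_conv_cross2
    using cross2_skew[of P ?B] cross2_skew[of Q ?D] cross2_skew[of R ?F] 
      cross2_skew[of P ?A] cross2_skew[of ?A R] cross2_skew[of P Q] cross2_skew[of R P] by linarith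
  obtain s where s: "Q - P = s *\<^sub>R (?F - ?C)" using segment_diff[OF P(2) Q(2)] .
  obtain r where r: "R - P = r *\<^sub>R (?D - ?A)" using segment_diff[OF P(1) R(1)] .
  obtain x where x: "R - Q = x *\<^sub>R (?E - ?B)" using segment_diff[OF Q(1) R(2)] .
  have pos: "orient ?C ?D ?F > 0" "orient ?A ?C ?F > 0" "orient ?B ?D ?E > 0" "orient ?A ?B ?E > 0"
    "orient ?B ?C ?E > 0" "orient ?B ?E ?F > 0"
    by (auto intro!: cycle_pos[OF v])
  have "orient P Q R \<ge> 0"
  proof (rule diagonal_triangle_nonneg[of "?C - ?F" "?D - ?A" "?E - ?B"])
    show "cross2 (?C - ?F) (?D - ?A) > 0"
      using pos(1,2) by (simp add: orient_def cross2_def algebra_simps)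
    show "cross2 (?E - ?B) (?D - ?A) \<le> 0"
      using pos(3,4) by (simp add: orient_def cross2_def algebra_simps)
    show "cross2 (?E - ?B) (?C - ?F) \<le> 0"
      using pos(5,6) by (simp add: orient_def cross2_def algebra_simps)
    show "Q - P = (-s) *\<^sub>R (?C - ?F)" using s by (simp add: algebra_simps)
  qed (use r x in auto)
  then show ?thesis using tri split by linarith
qed

lemma min_ear_le_nth:
  assumes v: "convex_cycle n v" and n: "n \<ge> 6"
    and ears: "\<And>i. t \<le> orient (v i) (v (Suc i)) (v (i + 2))"
  shows "real n * t \<le> cycle_area2 n v"
  using ears_le_hexagon[of v t] ears_le_of_deep_point[OF v, of t] v n ears
  by (cases "n = 6") auto

section \<open>The least ear is of cubic order\<close>

lemma sum_periodic_shift: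
  fixes F :: "nat \<Rightarrow> real"
  assumes "\<And>i. F (i + n) = F i"
  shows "(\<Sum>i<n. F (i + c)) = (\<Sum>i<n. F i)"
proof (induction c)
  case (Suc c)
  have "(\<Sum>i<n. F (i + Suc c)) + F c = (\<Sum>i<Suc n. F (i + c))"
    by (subst sum.lessThan_Suc_shift) simp
  also have "\<dots> = (\<Sum>i<n. F (i + c)) + F c" using assms[of c] by (simp add: add.commute)
  finally show ?case using Suc by simp
qed simp

lemma finite_attains_max:
  fixes f :: "'a \<Rightarrow> real"
  assumes "finite S" "S \<noteq> {}"
  obtains x where "x \<in> S" "\<And>y. y \<in> S \<Longrightarrow> f y \<le> f x"
proof -
  have "Max (f ` S) \<in> f ` S" using assms by (intro Max_in) auto
  then obtain x where x: "x \<in> S" "f x = Max (f ` S)" by auto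
  have "f y \<le> f x" if "y \<in> S" for y unfolding x(2) using assms(1) that by (intro Max_ge) auto
  then show ?thesis using that x(1) by blast
qed

lemma linear_segment_le:
  fixes h :: "real^2 \<Rightarrow> real"
  assumes "linear h" "p \<in> closed_segment x y"
  shows "h p \<le> max (h x) (h y)" "min (h x) (h y) \<le> h p"
proof -
  obtain a where a: "0 \<le> a" "a \<le> 1" "p = (1 - a) *\<^sub>R x + a *\<^sub>R y" using assms(2) by (auto simp: in_segment)
  have hp: "h p = (1 - a) * h x + a * h y" unfolding a(3) using assms(1) by (simp add: linear_add linear_scale)
  have "(1 - a) * h x + a * h y \<le> (1 - a) * max (h x) (h y) + a * max (h x) (h y)"
    using a by (intro add_mono mult_left_mono) auto
  then show "h p \<le> max (h x) (h y)" unfolding hp by (simp add: algebra_simps)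
  have "(1 - a) * min (h x) (h y) + a * min (h x) (h y) \<le> (1 - a) * h x + a * h y"
    using a by (intro add_mono mult_left_mono) auto
  then show "min (h x) (h y) \<le> h p" unfolding hp by (simp add: algebra_simps)
qed

text \<open>The two diagonals cross, so one cannot lie entirely above the other.\<close>

lemma diagonals_not_separated:
  assumes v: "convex_cycle n v" and h: "linear (h :: real^2 \<Rightarrow> real)"
    and ijkl: "i < j" "j < k" "k < l" "l < i + n"
    and le: "max (h (v i)) (h (v k)) < min (h (v j)) (h (v l))"
  shows False
proof -
  obtain p where p: "p \<in> closed_segment (v i) (v k)" "p \<in> closed_segment (v j) (v l)"
    using diagonals_of_cycle_cross[OF v ijkl] .
  then show False using linear_segment_le(1)[OF h p(1)] linear_segment_le(2)[OF h p(2)] le by linarith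
qed

text \<open>A linear function on a convex polygon has no local extrema besides its minimum and maximum: a further strict one
  would give two crossing diagonals at separated heights.\<close>

lemma total_variation:
  assumes v: "convex_cycle n v" and n: "n > 0" and h: "linear (h :: real^2 \<Rightarrow> real)"
    and bounds: "\<And>i. lo \<le> h (v i)" "\<And>i. h (v i) \<le> hi"
  shows "(\<Sum>i<n. \<bar>h (v (Suc i)) - h (v i)\<bar>) \<le> 2 * (hi - lo)"
proof -
  obtain c where "\<And>i. i < n \<Longrightarrow> h (v c) \<le> h (v i)"
    using finite_attains_max[of "{..<n}" "\<lambda>i. - h (v i)"] n by auto
  then have c: "h (v c) \<le> h (v i)" for i
    using cycle_mod[OF v, of i] n by (metis mod_less_divisor)
  define w where "w i = v (i + c)" for i
  have w: "convex_cycle n w" unfolding w_def by (rule cycle_shift[OF v])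
  have wn: "w n = w 0" using cycle_period[OF w, of 0] by simp
  have min: "h (w 0) \<le> h (w i)" for i using c by (simp add: w_def)
  obtain M where M: "M < n" "\<And>i. i < n \<Longrightarrow> h (w i) \<le> h (w M)"
    using finite_attains_max[of "{..<n}" "\<lambda>i. h (w i)"] n by auto
  have max: "h (w i) \<le> h (w M)" for i
    using M(2)[of "i mod n"] cycle_mod[OF w, of i] n by simp
  have up: "h (w i) \<le> h (w (Suc i))" if "i < M" for i
  proof (rule ccontr)
    assume less: "\<not> h (w i) \<le> h (w (Suc i))"
    have "0 < i" using min[of "Suc i"] less by (cases i) auto
    moreover have "Suc i < M" using max[of i] less that by (cases "Suc i = M") auto
    ultimately show False
      using diagonals_not_separated[OF w h, of 0 i "Suc i" M] less min[of "Suc i"] max[of i] M(1) by simp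
  qed
  have down: "h (w (Suc i)) \<le> h (w i)" if "M \<le> i" "i < n" for i
  proof (rule ccontr)
    assume less: "\<not> h (w (Suc i)) \<le> h (w i)"
    have "M < i" using max[of "Suc i"] less that by (cases "M = i") auto
    moreover have "Suc i < n" using min[of i] less that wn by (cases "Suc i = n") auto
    moreover have "M \<noteq> 0" using min[of i] max[of "Suc i"] less by (cases "M = 0") auto
    ultimately show False
      using diagonals_not_separated[OF w linear_compose_neg[OF h], of M i "Suc i" n]
        less min[of i] max[of "Suc i"] M(1) wn by simp
  qed
  have "(\<Sum>i<n. \<bar>h (v (Suc i)) - h (v i)\<bar>) = (\<Sum>i<n. \<bar>h (w (Suc i)) - h (w i)\<bar>)"
    using sum_periodic_shift[of "\<lambda>i. \<bar>h (v (Suc i)) - h (v i)\<bar>" n c] cycle_period[OF v] cycle_period[OF v, of "Suc _"]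
    by (simp add: w_def)
  also have "\<dots> = (\<Sum>i<M. \<bar>h (w (Suc i)) - h (w i)\<bar>) + (\<Sum>i=M..<n. \<bar>h (w (Suc i)) - h (w i)\<bar>)"
    using M(1) sum.atLeastLessThan_concat[of 0 M n "\<lambda>i. \<bar>h (w (Suc i)) - h (w i)\<bar>"] by (simp add: lessThan_atLeast0)
  also have "(\<Sum>i<M. \<bar>h (w (Suc i)) - h (w i)\<bar>) = (\<Sum>i<M. h (w (Suc i)) - h (w i))"
    using up by (intro sum.cong) auto
  also have "\<dots> = h (w M) - h (w 0)" by (rule sum_lessThan_telescope)
  also have "(\<Sum>i=M..<n. \<bar>h (w (Suc i)) - h (w i)\<bar>) = (\<Sum>i=M..<n. - (h (w (Suc i)) - h (w i)))"
    using down by (intro sum.cong) auto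
  also have "\<dots> = h (w M) - h (w n)" using M(1) sum_Suc_diff'[of M n "\<lambda>i. h (w i)"] by (subst sum_negf) simp
  finally show ?thesis using bounds(1)[of c] bounds(2)[of "M + c"] wn by (simp add: w_def)
qed

text \<open>If the height over the first edge fell and then rose again at vertex \<open>i + 1\<close>, the wedge at that vertex, which contains
  \<open>v 0\<close>, would lie above it; but \<open>v 0\<close> has height zero.\<close>

lemma edges_turn_once:
  assumes v: "convex_cycle n v" and i: "0 < i" "Suc i < n"
    and le: "cross2 (v 1 - v 0) (v (Suc i) - v i) \<le> 0"
  shows "cross2 (v 1 - v 0) (v (i + 2) - v (Suc i)) < 0"
proof (rule ccontr)
  assume "\<not> ?thesis"
  then have ge: "cross2 (v 1 - v 0) (v (i + 2) - v (Suc i)) \<ge> 0" by simp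
  define h where "h x = orient (v 0) (v 1) x" for x
  have diff: "cross2 (v 1 - v 0) (x - y) = h x - h y" for x y by (simp add: h_def orient_def cross2_add)
  have hb: "h (v (Suc i)) > 0" unfolding h_def using i by (intro cycle_pos[OF v]) auto
  have le': "h (v (Suc i)) \<le> h (v i)" and ge': "h (v (Suc i)) \<le> h (v (i + 2))"
    using le ge unfolding diff by simp_all
  have "i \<noteq> 1" using le' hb by (auto simp: h_def)
  then have i2: "2 \<le> i" using i by simp
  show False
  proof (cases "i + 2 = n")
    case True
    then have "h (v (i + 2)) = 0" using cycle_period[OF v, of 0] by (simp add: h_def)
    then show ?thesis using ge' hb by simp
  next
    case False
    let ?o = "v 0" and ?a = "v i" and ?b = "v (Suc i)" and ?c = "v (i + 2)"
    have pos: "orient ?o ?b ?c > 0" "orient ?o ?a ?b > 0" "orient ?a ?b ?c > 0"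
      using i i2 False by (auto intro!: cycle_pos[OF v])
    have "orient ?a ?b ?c * (h ?o - h ?b) = orient ?o ?b ?c * (h ?a - h ?b) + orient ?o ?a ?b * (h ?c - h ?b)"
      by (simp add: h_def orient_def cross2_def algebra_simps)
    also have "\<dots> \<ge> 0" using pos le' ge' by simp
    finally have "h ?o - h ?b \<ge> 0" using pos(3) by (simp add: zero_le_mult_iff)
    then show False using hb by (simp add: h_def)
  qed
qed

text \<open>By \<open>x y \<le> (x + y)\<^sup>2 / 4\<close> it reduces to \<open>(s - 2)\<^sup>2 (s + 1) \<ge> 0\<close> for \<open>s = x + y\<close>.\<close>

lemma amgm3:
  fixes x y z :: real
  assumes "0 \<le> x" "0 \<le> y" "0 \<le> z" "1 < x * y * z" shows "3 < x + y + z"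
proof (rule ccontr)
  assume "\<not> 3 < x + y + z"
  then have z: "z \<le> 3 - (x + y)" by simp
  have "(x - y)\<^sup>2 \<ge> 0" by simp
  then have "x * y \<le> (x + y)\<^sup>2 / 4" by (simp add: power2_eq_square algebra_simps)
  then have "x * y * z \<le> (x + y)\<^sup>2 / 4 * (3 - (x + y))" using z assms by (intro mult_mono) auto
  moreover have "((x + y) - 2)\<^sup>2 * ((x + y) + 1) \<ge> 0" using assms by (intro mult_nonneg_nonneg) auto
  then have "(x + y)\<^sup>2 / 4 * (3 - (x + y)) \<le> 1" by (simp add: power2_eq_square algebra_simps)
  ultimately show False using assms(4) by linarith
qed

text \<open>A cross product is at most the product of the two lengths and the angle between them. The three factors have means at
  most \<open>l/n\<close>, \<open>l/n\<close> and \<open>2\<pi>/n\<close>, hence not all products can exceed the product of these means.\<close>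

lemma turning_product_bound:
  fixes u :: "nat \<Rightarrow> real^2"
  assumes n: "0 < n" and closed: "u n = u 0"
    and pos: "\<And>i. i < n \<Longrightarrow> cross2 (u i) (u (Suc i)) > 0"
    and once: "\<And>i. 0 < i \<Longrightarrow> Suc i < n \<Longrightarrow> cross2 (u 0) (u i) \<le> 0 \<Longrightarrow> cross2 (u 0) (u (Suc i)) < 0"
    and len: "(\<Sum>i<n. norm (u i)) \<le> l"
    and t: "\<And>i. i < n \<Longrightarrow> t \<le> cross2 (u i) (u (Suc i))"
  shows "t \<le> (l / n)\<^sup>2 * (2 * pi / n)"
proof (rule ccontr)
  assume big: "\<not> ?thesis"
  obtain \<phi> where \<phi>: "0 \<le> \<phi> 0" "\<phi> n = \<phi> 0 + 2 * pi"
    "\<And>i. i \<le> n \<Longrightarrow> u i = norm (u i) *\<^sub>R dir (\<phi> i)"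
    "\<And>i. i < n \<Longrightarrow> \<phi> i < \<phi> (Suc i) \<and> \<phi> (Suc i) < \<phi> i + pi"
    using turning_angles[of n u, OF n closed pos once] by blast
  have "norm (u 0) > 0" using pos[OF n] by auto
  moreover have "norm (u 0) \<le> (\<Sum>i<n. norm (u i))" using n by (intro member_le_sum) auto
  ultimately have l: "l > 0" using len by linarith
  define a where "a = l / n"
  define b where "b = 2 * pi / n"
  have ab: "a > 0" "b > 0" using l n by (simp_all add: a_def b_def)
  have each: "3 < norm (u i) / a + norm (u (Suc i)) / a + (\<phi> (Suc i) - \<phi> i) / b" if i: "i < n" for i
  proof (rule amgm3)
    let ?d = "\<phi> (Suc i) - \<phi> i"
    have d: "0 < ?d" using \<phi>(4)[OF i] by simp
    have "cross2 (u i) (u (Suc i)) = norm (u i) * norm (u (Suc i)) * sin ?d"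
      using arg_cong2[where f = cross2, OF \<phi>(3)[of i] \<phi>(3)[of "Suc i"]] i by simp
    also have "\<dots> \<le> norm (u i) * norm (u (Suc i)) * ?d" using d by (intro mult_left_mono sin_x_le_x) auto
    finally have "a\<^sup>2 * b < norm (u i) * norm (u (Suc i)) * ?d" using big t[OF i] by (simp add: a_def b_def)
    then show "1 < norm (u i) / a * (norm (u (Suc i)) / a) * (?d / b)"
      using ab by (simp add: field_simps power2_eq_square)
    show "0 \<le> ?d / b" using d ab by simp
  qed (use ab in auto)
  have "(\<Sum>i<n. norm (u (Suc i))) = (\<Sum>i<n. norm (u i))"
    using sum.lessThan_Suc_shift[of "\<lambda>i. norm (u i)" n] closed by simp
  then have "(\<Sum>i<n. norm (u i) / a + norm (u (Suc i)) / a + (\<phi> (Suc i) - \<phi> i) / b)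
      = (\<Sum>i<n. norm (u i)) / a + (\<Sum>i<n. norm (u i)) / a + 2 * pi / b"
    using sum_lessThan_telescope[of \<phi> n] \<phi>(2) by (simp add: sum.distrib flip: sum_divide_distrib)
  also have "\<dots> \<le> l / a + l / a + 2 * pi / b" using ab len by (intro add_mono divide_right_mono) auto
  also have "\<dots> = real n * 3" using l n by (simp add: a_def b_def)
  finally have "(\<Sum>i<n. norm (u i) / a + norm (u (Suc i)) / a + (\<phi> (Suc i) - \<phi> i) / b) \<le> real n * 3" .
  moreover have "(\<Sum>i<n. 3) < (\<Sum>i<n. norm (u i) / a + norm (u (Suc i)) / a + (\<phi> (Suc i) - \<phi> i) / b)"
    using n each by (intro sum_strict_mono) auto
  ultimately show False by simp
qed

lemma farthest_pair:
  assumes "finite S" "S \<noteq> {}"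
  obtains p q where "p \<in> S" "q \<in> S" "\<And>x y. x \<in> S \<Longrightarrow> y \<in> S \<Longrightarrow> dist x y \<le> dist p (q :: real^2)"
proof -
  obtain z where "z \<in> S \<times> S" "\<And>y. y \<in> S \<times> S \<Longrightarrow> dist (fst y) (snd y) \<le> dist (fst z) (snd z)"
    using finite_attains_max[of "S \<times> S" "\<lambda>z. dist (fst z) (snd z)"] assms by blast
  then show ?thesis using that[of "fst z" "snd z"] by force
qed

lemma farthest_projection:
  fixes p q x :: "real^2"
  assumes "dist p x \<le> dist p q" "dist x q \<le> dist p q"
  shows "0 \<le> (q - p) \<bullet> (x - p)" "(q - p) \<bullet> (x - p) \<le> (q - p) \<bullet> (q - p)"
proof -
  have "(q - p) \<bullet> (x - p) \<le> norm (q - p) * norm (x - p)" by (rule norm_cauchy_schwarz)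
  also have "\<dots> \<le> norm (q - p) * norm (q - p)" using assms(1) by (intro mult_left_mono) (simp_all add: dist_norm norm_minus_commute)
  finally show "(q - p) \<bullet> (x - p) \<le> (q - p) \<bullet> (q - p)" by (simp add: dot_square_norm power2_eq_square)
  have "(norm (x - q))\<^sup>2 \<le> (norm (q - p))\<^sup>2" using assms(2) by (intro power_mono) (simp_all add: dist_norm norm_minus_commute)
  moreover have "(norm (x - q))\<^sup>2 = (norm (x - p))\<^sup>2 + (norm (q - p))\<^sup>2 - 2 * ((q - p) \<bullet> (x - p))"
    by (simp add: power2_norm_eq_inner inner_diff_left inner_diff_right inner_commute)
  ultimately show "0 \<le> (q - p) \<bullet> (x - p)" by (smt (verit) zero_le_power2)
qed

text \<open>The triangles over \<open>p q\<close> with apexes \<open>r\<close> and \<open>s\<close> lie on opposite sides of that chord.\<close>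

lemma width_le_area:
  assumes v: "convex_cycle n v" and n: "n > 0" and pq: "p \<in> range v" "q \<in> range v" "p \<noteq> q"
    and rs: "r \<in> range v" "s \<in> range v" "orient p q r \<ge> 0" "orient p q s \<le> 0"
  shows "orient p q r - orient p q s \<le> cycle_area2 n v"
proof -
  let ?P = "convex hull (range v)"
  let ?R = "convex hull {p, q, r}" and ?S = "convex hull {p, q, s}"
  have "orient p q x \<ge> 0" if "x \<in> ?R" for x by (rule orient_hull_ge[OF that]) (use rs in auto)
  moreover have "?S \<subseteq> {x. orient p q x \<le> 0}" using rs by (intro hull_minimal orient_halfplane) auto
  ultimately have "negligible (?R \<inter> ?S)"
    by (intro negligible_subset[OF negligible_orient_line[OF pq(3), of 0]]) force
  then have "area (?R \<union> ?S) = orient p q r / 2 - orient p q s / 2"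
    using area_Un_negligible[of ?R ?S] rs by (simp add: hull_lmeasurable area_triangle)
  moreover have "area (?R \<union> ?S) \<le> area ?P"
  proof (rule measure_mono_fmeasurable)
    show "?R \<union> ?S \<subseteq> ?P" using pq rs by (intro Un_least hull_mono) auto
    show "?R \<union> ?S \<in> sets lebesgue" by (intro sets.Un fmeasurableD hull_lmeasurable) auto
  qed (rule cycle_lmeasurable[OF v n])
  ultimately show ?thesis using area_cycle[OF v n] by simp
qed

text \<open>The vectors \<open>u\<close> are the edges after the linear map that takes the bounding rectangle along the diameter \<open>p q\<close>
  to the unit square. This map divides areas by \<open>H\<close>, which is at most twice the area of the
  polygon. By \<open>total_variation\<close> each coordinate contributes at most 2 to the sum of the lengths.\<close>

lemma min_ear_le_cubic:
  assumes v: "convex_cycle n v" and n: "n \<ge> 3"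
    and ears: "\<And>i. t \<le> orient (v i) (v (Suc i)) (v (i + 2))"
  shows "t \<le> 32 * pi / real n ^ 3 * cycle_area2 n v"
proof -
  have n0: "n > 0" using n by simp
  have fin: "finite (range v)" using cycle_image_lessThan[OF v n0] by (metis finite_imageI finite_lessThan)
  obtain p q where pq: "p \<in> range v" "q \<in> range v" and far: "\<And>x y. x \<in> range v \<Longrightarrow> y \<in> range v \<Longrightarrow> dist x y \<le> dist p q"
    using farthest_pair[OF fin] by blast
  have tri: "orient (v 0) (v 1) (v 2) > 0" using n by (intro cycle_pos[OF v]) auto
  then have "v 0 \<noteq> v 1" by auto
  then have "dist p q > 0" using far[of "v 0" "v 1"] by (smt (verit) rangeI zero_less_dist_iff)
  then have ne: "p \<noteq> q" by simp
  define d where "d = q - p"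
  define W where "W = d \<bullet> d"
  have W: "W > 0" using ne by (simp add: W_def d_def)
  \<comment> \<open>\<open>g\<close> is the distance from the line \<open>p q\<close> times the length of \<open>p q\<close>, so \<open>H\<close> below is the area of the rectangle.\<close>
  define g where "g x = orient p q x" for x
  obtain r where r: "r \<in> range v" "\<And>x. x \<in> range v \<Longrightarrow> g x \<le> g r"
    using finite_attains_max[OF fin, of g] by blast
  obtain s where s: "s \<in> range v" "\<And>x. x \<in> range v \<Longrightarrow> g s \<le> g x"
    using finite_attains_max[OF fin, of "\<lambda>x. - g x"] by auto
  have gp: "g p = 0" by (simp add: g_def)
  define H where "H = g r - g s"
  have HA: "H \<le> cycle_area2 n v"
    using width_le_area[OF v n0 pq ne r(1) s(1)] r(2)[OF pq(1)] s(2)[OF pq(1)] gp by (simp add: H_def g_def)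
  have lagrange: "(d \<bullet> x) * cross2 d y - (d \<bullet> y) * cross2 d x = W * cross2 x y" for x y
    by (simp add: W_def cross2_def inner_vec_def sum_2 algebra_simps)
  have gd: "g x - g y = cross2 d (x - y)" for x y by (simp add: g_def orient_def d_def cross2_add)
  have H: "H > 0"
  proof (rule ccontr)
    assume "\<not> H > 0"
    then have "g x = g y" if "x \<in> range v" "y \<in> range v" for x y
      using r(2)[OF that(1)] r(2)[OF that(2)] s(2)[OF that(1)] s(2)[OF that(2)] by (simp add: H_def)
    then have "cross2 d (v 1 - v 0) = 0" "cross2 d (v 2 - v 0) = 0" by (simp_all flip: gd)
    then have "W * orient (v 0) (v 1) (v 2) = 0" unfolding orient_def lagrange[symmetric] by simp
    then show False using W tri by simp
  qed
  define e where "e i = v (Suc i) - v i" for i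
  define u :: "nat \<Rightarrow> real^2" where "u i = vector [d \<bullet> e i / W, cross2 d (e i) / H]" for i
  have cu: "cross2 (u i) (u j) = cross2 (e i) (e j) / H" for i j
  proof -
    have "cross2 (u i) (u j) = ((d \<bullet> e i) * cross2 d (e j) - (d \<bullet> e j) * cross2 d (e i)) / (W * H)"
      by (simp add: cross2_def[of "u i" for i] cross2_def[of "vector _"] u_def diff_divide_distrib mult.commute)
    then show ?thesis unfolding lagrange using W by simp
  qed
  have ear: "cross2 (e i) (e (Suc i)) = orient (v i) (v (Suc i)) (v (i + 2))" for i
    by (simp add: e_def orient_def cross2_def algebra_simps)
  have "t / H \<le> (4 / n)\<^sup>2 * (2 * pi / n)"
  proof (rule turning_product_bound[of n u])
    show "u n = u 0" using cycle_period[OF v, of 0] cycle_period[OF v, of 1] by (simp add: u_def e_def)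
    show "cross2 (u i) (u (Suc i)) > 0" for i
      unfolding cu ear using H n cycle_pos[OF v, of i "Suc i" "i + 2"] by simp
    show "t / H \<le> cross2 (u i) (u (Suc i))" for i
      unfolding cu ear using H ears[of i] by (simp add: divide_right_mono)
    show "cross2 (u 0) (u (Suc i)) < 0" if "0 < i" "Suc i < n" "cross2 (u 0) (u i) \<le> 0" for i
      using edges_turn_once[OF v that(1,2)] that(3) H unfolding cu by (simp add: e_def divide_less_0_iff divide_le_0_iff)
    have "(\<Sum>i<n. norm (u i)) \<le> (\<Sum>i<n. \<bar>d \<bullet> v (Suc i) - d \<bullet> v i\<bar> / W + \<bar>cross2 d (v (Suc i)) - cross2 d (v i)\<bar> / H)"
    proof (rule sum_mono)
      fix i
      have "norm (u i) \<le> \<bar>u i $ 1\<bar> + \<bar>u i $ 2\<bar>" using norm_le_l1_cart[of "u i"] by (simp add: sum_2)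
      then show "norm (u i) \<le> \<bar>d \<bullet> v (Suc i) - d \<bullet> v i\<bar> / W + \<bar>cross2 d (v (Suc i)) - cross2 d (v i)\<bar> / H"
        using W H by (simp add: u_def e_def inner_diff_right cross2_add)
    qed
    also have "\<dots> = (\<Sum>i<n. \<bar>d \<bullet> v (Suc i) - d \<bullet> v i\<bar>) / W + (\<Sum>i<n. \<bar>cross2 d (v (Suc i)) - cross2 d (v i)\<bar>) / H"
      by (simp add: sum.distrib sum_divide_distrib)
    also have "\<dots> \<le> 2 * W / W + 2 * H / H"
    proof (intro add_mono divide_right_mono)
      have "(\<Sum>i<n. \<bar>d \<bullet> v (Suc i) - d \<bullet> v i\<bar>) \<le> 2 * (d \<bullet> q - d \<bullet> p)"
      proof (rule total_variation[OF v n0, of "\<lambda>x. d \<bullet> x"])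
        show "linear (\<lambda>x. d \<bullet> x)" by (rule bounded_linear.linear[OF bounded_linear_inner_right])
        have "dist p x \<le> dist p q" "dist x q \<le> dist p q" if "x \<in> range v" for x using far pq that by auto
        from farthest_projection[OF this] 
        show "d \<bullet> p \<le> d \<bullet> v i" "d \<bullet> v i \<le> d \<bullet> q" for i unfolding d_def[symmetric] by (simp_all add: inner_diff_right d_def)
      qed
      also have "d \<bullet> q - d \<bullet> p = W" by (simp add: W_def d_def inner_diff_right inner_diff_left)
      finally show "(\<Sum>i<n. \<bar>d \<bullet> v (Suc i) - d \<bullet> v i\<bar>) \<le> 2 * W" .
      have "(\<Sum>i<n. \<bar>cross2 d (v (Suc i)) - cross2 d (v i)\<bar>) \<le> 2 * (cross2 d r - cross2 d s)"
      proof (rule total_variation[OF v n0, of "cross2 d"])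
        show "linear (cross2 d)" by (intro linearI) (simp_all add: cross2_add)
        show "cross2 d s \<le> cross2 d (v i)" "cross2 d (v i) \<le> cross2 d r" for i
          using r(2)[of "v i"] s(2)[of "v i"] gd[of r "v i"] gd[of "v i" s] by (simp_all add: cross2_add)
      qed
      then show "(\<Sum>i<n. \<bar>cross2 d (v (Suc i)) - cross2 d (v i)\<bar>) \<le> 2 * H"
        unfolding H_def gd by (simp add: cross2_add)
    qed (use W H in auto)
    finally show "(\<Sum>i<n. norm (u i)) \<le> 4" using W H by simp
  qed (use n0 in auto)
  then have "t \<le> 32 * pi / real n ^ 3 * H" using H n by (simp add: field_simps power2_eq_square power3_eq_cube)
  also have "\<dots> \<le> 32 * pi / real n ^ 3 * cycle_area2 n v" by (rule mult_left_mono[OF HA]) simp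
  finally show ?thesis .
qed

section \<open>Extremal area ratios\<close>

lemma ngon_area_pos:
  assumes v: "convex_cycle n v" and n: "n \<ge> 3"
  shows "area (convex hull (range v)) > 0"
proof -
  have o: "orient (v 0) (v 1) (v 2) > 0" using n by (intro cycle_pos[OF v]) auto
  have "0 < area (convex hull {v 0, v 1, v 2})" using o by (simp add: area_triangle)
  also have "\<dots> \<le> area (convex hull (range v))"
  proof (rule measure_mono_fmeasurable)
    show "convex hull {v 0, v 1, v 2} \<in> sets lebesgue" by (intro fmeasurableD hull_lmeasurable) simp
    show "convex hull (range v) \<in> lmeasurable" using cycle_lmeasurable[OF v] n by simp
  qed (auto intro!: hull_mono)
  finally show ?thesis .
qed

text \<open>From \<open>sin x \<ge> x cos x\<close> and \<open>cos (\<pi>/6) = sqrt 3 / 2\<close>; the constant \<open>2/\<pi>\<close> is the one needed to absorb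
  \<open>32 \<pi> / n\<^sup>3\<close> and is below \<open>3/4\<close>.\<close>

lemma sin_lower_bound:
  assumes "0 \<le> x" "x \<le> pi / 6" shows "2 / pi * x\<^sup>2 \<le> (sin x)\<^sup>2"
proof -
  have "x * cos x \<le> sin x"
  proof -
    have "sin 0 - 0 * cos 0 \<le> sin x - x * cos x"
    proof (rule DERIV_nonneg_imp_nondecreasing[OF assms(1)])
      fix y assume y: "0 \<le> y" "y \<le> x"
      have "((\<lambda>y. sin y - y * cos y) has_real_derivative y * sin y) (at y)"
        by (auto intro!: derivative_eq_intros)
      moreover have "0 \<le> y * sin y" using y assms by (intro mult_nonneg_nonneg sin_ge_zero) auto
      ultimately show "\<exists>z. ((\<lambda>y. sin y - y * cos y) has_real_derivative z) (at y) \<and> 0 \<le> z" by blast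
    qed
    then show ?thesis by simp
  qed
  moreover have "cos (pi / 6) \<le> cos x" using assms by (intro cos_monotone_0_pi_le) auto
  then have c: "sqrt 3 / 2 \<le> cos x" by (simp add: cos_30)
  have "x * (sqrt 3 / 2) \<le> x * cos x" using c assms by (intro mult_left_mono) auto
  ultimately have "x * (sqrt 3 / 2) \<le> sin x" by linarith
  then have "(x * (sqrt 3 / 2))\<^sup>2 \<le> (sin x)\<^sup>2" using assms by (intro power_mono) auto
  then have "3 / 4 * x\<^sup>2 \<le> (sin x)\<^sup>2" by (simp add: power_mult_distrib power_divide)
  moreover have "2 / pi * x\<^sup>2 \<le> 3 / 4 * x\<^sup>2"
    using pi_approx by (intro mult_right_mono) (auto simp: divide_simps)
  ultimately show ?thesis by linarith
qed

text \<open>For \<open>n \<le> 12\<close> the angle \<open>2\<pi>/n\<close> is between \<open>\<pi>/6\<close> and \<open>\<pi>/3\<close>, so the first bound does not exceed the second; for larger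
  \<open>n\<close> the cubic bound is below the second.\<close>

lemma small_ear:
  assumes v: "convex_cycle n v" and n: "n \<ge> 6"
  obtains i where "orient (v i) (v (Suc i)) (v (i + 2)) \<le>
    min (1 / real n) (4 / real n * (sin (2 * pi / real n))\<^sup>2) * cycle_area2 n v"
proof -
  let ?ear = "\<lambda>i. orient (v i) (v (Suc i)) (v (i + 2))"
  obtain i where "\<And>j. j < n \<Longrightarrow> ?ear i \<le> ?ear j"
    using finite_attains_max[of "{..<n}" "\<lambda>i. - ?ear i"] n by auto
  moreover have "?ear (j mod n) = ?ear j" for j
    using cycle_mod[OF cycle_shift[OF v, of 1], of j] cycle_mod[OF cycle_shift[OF v, of 2], of j] cycle_mod[OF v, of j] by simp
  ultimately have ears: "?ear i \<le> ?ear j" for j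
    using n by (metis less_le_trans mod_less_divisor zero_less_numeral)
  have A: "cycle_area2 n v > 0" using ngon_area_pos[OF v] area_cycle[OF v] n by simp
  have one: "?ear i \<le> 1 / n * cycle_area2 n v"
    using min_ear_le_nth[OF v n ears] n by (simp add: field_simps)
  have "?ear i \<le> 4 / n * (sin (2 * pi / n))\<^sup>2 * cycle_area2 n v"
  proof (cases "n \<le> 12")
    case True
    have "sin (pi / 6) \<le> sin (2 * pi / n)" using n True by (intro sin_monotone_2pi_le) (auto simp: field_simps)
    then have "(1 / 2)\<^sup>2 \<le> (sin (2 * pi / n))\<^sup>2" by (intro power_mono) (auto simp: sin_30)
    then have "1 / n \<le> 4 / n * (sin (2 * pi / n))\<^sup>2" using n by (simp add: divide_simps power2_eq_square)
    then have "1 / n * cycle_area2 n v \<le> 4 / n * (sin (2 * pi / n))\<^sup>2 * cycle_area2 n v"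
      using A by (intro mult_right_mono) auto
    then show ?thesis using one by linarith
  next
    case False
    have "?ear i \<le> 32 * pi / real n ^ 3 * cycle_area2 n v" using min_ear_le_cubic[OF v _ ears] n by simp
    also have "32 * pi / real n ^ 3 = 4 / n * (2 / pi * (2 * pi / n)\<^sup>2)"
      by (simp add: power2_eq_square power3_eq_cube)
    also have "\<dots> * cycle_area2 n v \<le> 4 / n * (sin (2 * pi / n))\<^sup>2 * cycle_area2 n v"
      using A False by (intro mult_right_mono mult_left_mono sin_lower_bound) (auto simp: field_simps)
    finally show ?thesis .
  qed
  then show ?thesis using that[of i] one by (auto simp: min_def)
qed

lemma area_ratio_bounds:
  assumes "convex_ngon n P" "n \<ge> 3" "convex_ngon m Q" "m \<ge> 3" "Q \<subseteq> P"
  shows "0 \<le> area Q / area P" "area Q / area P \<le> 1"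
proof -
  obtain v where v: "convex_cycle n v" "P = convex hull (range v)" using cycle_of_convex_ngon[OF assms(1,2)] .
  obtain w where w: "convex_cycle m w" "Q = convex hull (range w)" using cycle_of_convex_ngon[OF assms(3,4)] .
  have "area Q \<le> area P" using assms(5) unfolding v(2) w(2)
    using cycle_lmeasurable[OF v(1)] cycle_lmeasurable[OF w(1)] assms(2,4)
    by (intro measure_mono_fmeasurable fmeasurableD) auto
  then show "area Q / area P \<le> 1" "0 \<le> area Q / area P"
    using ngon_area_pos[OF v(1) assms(2)] unfolding v(2) by auto
qed

lemma max_area_ratio_lower:
  assumes P: "convex_ngon n P" and n: "n \<ge> 6"
  shows "1 - min (1 / real n) (4 / real n * (sin (2 * pi / real n))\<^sup>2) \<le> max_area_ratio (n - 1) P"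
proof -
  let ?c = "min (1 / real n) (4 / real n * (sin (2 * pi / real n))\<^sup>2)"
  have n3: "n \<ge> 3" "n \<ge> 4" using n by auto
  obtain v where v: "convex_cycle n v" "P = convex hull (range v)" using cycle_of_convex_ngon[OF P n3(1)] .
  have A: "area P > 0" "area P = cycle_area2 n v / 2" using ngon_area_pos[OF v(1)] area_cycle[OF v(1)] v(2) n by auto
  obtain i where i: "orient (v i) (v (Suc i)) (v (i + 2)) \<le> ?c * cycle_area2 n v" using small_ear[OF v(1) n] .
  obtain Q where Q: "convex_ngon (n - 1) Q" "Q \<subseteq> P" "area Q = area P - orient (v i) (v (Suc i)) (v (i + 2)) / 2"
    using ear_removal[OF v(1) n3(2), of i] v(2) by auto
  have "cycle_area2 n v = 2 * area P" using A(2) by simp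
  then have "orient (v i) (v (Suc i)) (v (i + 2)) / 2 \<le> ?c * area P" using i by (simp only: mult.left_commute)
  then have "(1 - ?c) * area P \<le> area Q" unfolding Q(3) left_diff_distrib by simp
  then have "1 - ?c \<le> area Q / area P" using A(1) by (simp add: pos_le_divide_eq)
  also have "\<dots> \<le> max_area_ratio (n - 1) P" unfolding max_area_ratio_def
  proof (rule cSUP_upper)
    show "bdd_above ((\<lambda>Q. area Q / area P) ` {Q. convex_ngon (n - 1) Q \<and> Q \<subseteq> P})"
      using area_ratio_bounds(2)[OF P n3(1), of "n - 1"] n by (intro bdd_aboveI2[of _ _ 1]) auto
  qed (use Q in auto)
  finally show ?thesis .
qed

lemma max_area_ratio_regular:
  assumes n: "n \<ge> 6"
  shows "max_area_ratio (n - 1) (convex hull (range (regular n))) \<le> 1 - 4 / real n * (sin (pi / real n))\<^sup>2"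
  unfolding max_area_ratio_def
proof (rule cSUP_least)
  let ?P = "convex hull (range (regular n))"
  have rc: "convex_cycle n (regular n)" using n by (intro regular_cycle) simp
  show "{Q. convex_ngon (n - 1) Q \<and> Q \<subseteq> ?P} \<noteq> {}"
    using ear_removal[OF rc, of 0] n by auto
  fix Q assume "Q \<in> {Q. convex_ngon (n - 1) Q \<and> Q \<subseteq> ?P}"
  then show "area Q / area ?P \<le> 1 - 4 / real n * (sin (pi / real n))\<^sup>2"
    using regular_inscribed_area[OF n, of Q] ngon_area_pos[OF rc] n by (simp add: pos_divide_le_eq)
qed

theorem mainTheorem1:
  fixes n :: nat
  assumes "n \<ge> 6"
  shows "4 / real n * (sin (pi / real n))\<^sup>2 \<le> 1 - f_ratio n (n - 1)
    \<and> 1 - f_ratio n (n - 1) \<le> min (1 / real n) (4 / real n * (sin (2 * pi / real n))\<^sup>2)"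
proof -
  let ?R = "convex hull (range (regular n))" and ?c = "min (1 / real n) (4 / real n * (sin (2 * pi / real n))\<^sup>2)"
  have R: "convex_ngon n ?R" using convex_ngon_of_cycle[OF regular_cycle] assms by simp
  have low: "1 - ?c \<le> max_area_ratio (n - 1) P" if "convex_ngon n P" for P
    by (rule max_area_ratio_lower[OF that assms])
  have "f_ratio n (n - 1) \<le> max_area_ratio (n - 1) ?R" unfolding f_ratio_def
    by (rule cINF_lower) (use R low in \<open>auto intro!: bdd_belowI2[of _ "1 - ?c"]\<close>)
  then have "f_ratio n (n - 1) \<le> 1 - 4 / real n * (sin (pi / real n))\<^sup>2"
    using max_area_ratio_regular[OF assms] by linarith
  moreover have "1 - ?c \<le> f_ratio n (n - 1)" unfolding f_ratio_def
    by (rule cINF_greatest) (use R low in auto)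
  ultimately show ?thesis by linarith
qed

end
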